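(* Let $2\le n<\infty$. Up to equivalence there is a unique cell system on $\mathcal{A}^{(2n+1)\ast}$, given by $$W_{i-1,i,i}=\frac{\sqrt{[i][2i-3][2i-1]}}{\sqrt{[i-1]}},\quad i=2,\ldots,n,$$ $$W_{i,i,i+1}=\frac{\sqrt{[i-1][2i-1][2i+1]}}{\sqrt{[i]}},\quad i=2,\ldots,n-1,$$ $$W_{i,i,i}=(-1)^{i+1}\frac{[2i-1]}{\sqrt{[i-1][i]}},\quad i=2,\ldots,n.$$
   Context: Let $q=e^{\pi i/(2n+1)}$ and $[m]=(q^m-q^{-m})/(q-q^{-1})$. The graph $\mathcal{A}^{(2n+1)\ast}$ has vertices $1,\ldots,n$, one edge $i\to i+1$ and one edge $i+1\to i$ for $1\le i\le n-1$, and one loop $i\to i$ for each $i=2,\ldots,n$ (no loop at $1$). Its Perron-Frobenius eigenvector (eigenvalue $[3]$) is $\phi_i=[2i-1]$. $W_{a,b,c}$ denotes the value of $W$ on the triangle $a\to b\to c\to a$. Cell systems: let $\mathcal{G}$ be a directed graph (loops and multiple edges allowed), with source and range maps $s,r$, Perron-Frobenius eigenvalue $[3]$ and positive Perron-Frobenius eigenvector $(\phi_i)$. A triangle $\triangle_{ijk}^{(\alpha\beta\gamma)}$ is a closed path $i\xrightarrow{\alpha}j\xrightarrow{\beta}k\xrightarrow{\gamma}i$, considered up to cyclic rotation. A cell system $W$ assigns to each triangle a complex number $W(\triangle_{ijk}^{(\alpha\beta\gamma)})$ such that: (I) for all edges $\alpha,\alpha'$ from $i$ to $j$, $\sum_{k,\beta,\gamma}W(\triangle_{ijk}^{(\alpha\beta\gamma)})\overline{W(\triangle_{ijk}^{(\alpha'\beta\gamma)})}=\delta_{\alpha,\alpha'}[2]\phi_i\phi_j$,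 the sum being over vertices $k$ and edges $\beta:j\to k$, $\gamma:k\to i$; (II) for all edges $\alpha_1,\dots,\alpha_4$ with $s(\alpha_1)=s(\alpha_4)=i_1$, $r(\alpha_1)=r(\alpha_2)=i_2$, $s(\alpha_2)=s(\alpha_3)=i_3$, $r(\alpha_3)=r(\alpha_4)=i_4$, $$\sum\phi_k^{-1}W(\triangle_{i_1i_2k}^{(\alpha_1\beta_1\beta_2)})\overline{W(\triangle_{i_3i_2k}^{(\alpha_2\beta_1\beta_3)})}W(\triangle_{i_3i_4k}^{(\alpha_3\beta_4\beta_3)})\overline{W(\triangle_{i_1i_4k}^{(\alpha_4\beta_4\beta_2)})}=\delta_{\alpha_1,\alpha_4}\delta_{\alpha_2,\alpha_3}\phi_{i_1}\phi_{i_2}\phi_{i_3}+\delta_{\alpha_1,\alpha_2}\delta_{\alpha_3,\alpha_4}\phi_{i_1}\phi_{i_2}\phi_{i_4},$$ the sum being over vertices $k$ and edges $\beta_1:i_2\to k$, $\beta_2:k\to i_1$, $\beta_3:k\to i_3$, $\beta_4:i_4\to k$. Two cell systems $W_1,W_2$ on $\mathcal{G}$ are equivalent if for each pair of adjacent vertices $i,j$ there is a unitary matrix $(u(\sigma,\sigma'))$ indexed by the edges from $i$ to $j$ such that for every triangle $W_1(\triangle_{ijk}^{(\sigma\rho\gamma)})=\sum_{\sigma',\rho',\gamma'}u(\sigma,\sigma')u(\rho,\rho')u(\gamma,\gamma')W_2(\triangle_{ijk}^{(\sigma'\rho'\gamma')})$, summing over edges $\sigma':i\to j$, $\rho':j\to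 k$, $\gamma':k\to i$. *)

theory Defs
  imports "HOL-Analysis.Analysis" "Graph_Theory.Digraph"
begin

text \<open>
  \<open>qint h m\<close> is $[m] = (q^m - q^{-m})/(q - q^{-1})$ for $q = e^{\pi i/h}$. As $|q| = 1$ this
  complex number is real (lemma \<open>of_real_qint\<close>), so passing to the real part loses nothing; it
  only makes $[m]$ available as a real number.
\<close>

definition qroot :: "nat \<Rightarrow> complex" where
  "qroot h = exp (\<i> * of_real pi / of_nat h)"

definition qint :: "nat \<Rightarrow> nat \<Rightarrow> real" where
  "qint h m = Re ((qroot h ^ m - inverse (qroot h) ^ m) / (qroot h - inverse (qroot h)))"

lemma of_real_qint:
  "complex_of_real (qint h m) =
     (qroot h ^ m - inverse (qroot h) ^ m) / (qroot h - inverse (qroot h))"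
proof -
  have inv: "inverse (qroot h) = cnj (qroot h)"
    by (simp add: qroot_def exp_cnj flip: exp_minus)
  have "cnj ((qroot h ^ m - inverse (qroot h) ^ m) / (qroot h - inverse (qroot h)))
      = (qroot h ^ m - inverse (qroot h) ^ m) / (qroot h - inverse (qroot h))"
    unfolding inv by (simp add: divide_simps) (simp add: algebra_simps)
  then show ?thesis
    unfolding qint_def by (metis Reals_cnj_iff of_real_Re)
qed

definition arcs_from_to :: "('a, 'b) pre_digraph \<Rightarrow> 'a \<Rightarrow> 'a \<Rightarrow> 'b set" where
  "arcs_from_to G i j = {e \<in> arcs G. tail G e = i \<and> head G e = j}"

definition triangle :: "('a, 'b) pre_digraph \<Rightarrow> 'b \<Rightarrow> 'b \<Rightarrow> 'b \<Rightarrow> bool" where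
  "triangle G \<alpha> \<beta> \<gamma> \<longleftrightarrow> \<alpha> \<in> arcs G \<and> \<beta> \<in> arcs G \<and> \<gamma> \<in> arcs G \<and>
     head G \<alpha> = tail G \<beta> \<and> head G \<beta> = tail G \<gamma> \<and> head G \<gamma> = tail G \<alpha>"

text \<open>
  The adjacency matrix acts on column vectors, its entry at \<open>(i, j)\<close> being the number of arcs from
  \<open>i\<close> to \<open>j\<close>; the Perron-Frobenius eigenvalue is its spectral radius over the complex numbers.
\<close>

locale perron_frobenius_digraph = fin_digraph G
  for G :: "('a, 'b) pre_digraph" and h :: nat and \<phi> :: "'a \<Rightarrow> real" +
  assumes eigenvector_pos: "i \<in> verts G \<Longrightarrow> 0 < \<phi> i"
    and eigenvector:
      "i \<in> verts G \<Longrightarrow> (\<Sum>j\<in>verts G. real (card (arcs_from_to G i j)) * \<phi> j) = qint h 3 * \<phi> i"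
    and eigenvalue_maximal:
      "\<And>(\<mu> :: complex) (v :: 'a \<Rightarrow> complex).
         (\<exists>i\<in>verts G. v i \<noteq> 0) \<Longrightarrow>
         (\<forall>i\<in>verts G. (\<Sum>j\<in>verts G. of_nat (card (arcs_from_to G i j)) * v j) = \<mu> * v i) \<Longrightarrow>
         cmod \<mu> \<le> qint h 3"

text \<open>
  A function on closed paths of length three taken up to rotation is encoded as a function of the
  three successive arcs that is invariant under rotation; its values off the triangles of the graph
  are irrelevant.
\<close>

locale cell_system = perron_frobenius_digraph G h \<phi>
  for G :: "('a, 'b) pre_digraph" and h :: nat and \<phi> :: "'a \<Rightarrow> real" +
  fixes W :: "'b \<Rightarrow> 'b \<Rightarrow> 'b \<Rightarrow> complex"
  assumes rotation: "triangle G \<alpha> \<beta> \<gamma> \<Longrightarrow> W \<alpha> \<beta> \<gamma> = W \<beta> \<gamma> \<alpha>"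
    and type_I:
      "\<lbrakk>i \<in> verts G; j \<in> verts G; \<alpha> \<in> arcs_from_to G i j; \<alpha>' \<in> arcs_from_to G i j\<rbrakk> \<Longrightarrow>
       (\<Sum>k\<in>verts G. \<Sum>\<beta>\<in>arcs_from_to G j k. \<Sum>\<gamma>\<in>arcs_from_to G k i.
          W \<alpha> \<beta> \<gamma> * cnj (W \<alpha>' \<beta> \<gamma>))
       = of_bool (\<alpha> = \<alpha>') * of_real (qint h 2 * \<phi> i * \<phi> j)"
    and type_II:
      "\<lbrakk>i\<^sub>1 \<in> verts G; i\<^sub>2 \<in> verts G; i\<^sub>3 \<in> verts G; i\<^sub>4 \<in> verts G;
        \<alpha>\<^sub>1 \<in> arcs_from_to G i\<^sub>1 i\<^sub>2; \<alpha>\<^sub>2 \<in> arcs_from_to G i\<^sub>3 i\<^sub>2;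
        \<alpha>\<^sub>3 \<in> arcs_from_to G i\<^sub>3 i\<^sub>4; \<alpha>\<^sub>4 \<in> arcs_from_to G i\<^sub>1 i\<^sub>4\<rbrakk> \<Longrightarrow>
       (\<Sum>k\<in>verts G. \<Sum>\<beta>\<^sub>1\<in>arcs_from_to G i\<^sub>2 k. \<Sum>\<beta>\<^sub>2\<in>arcs_from_to G k i\<^sub>1.
        \<Sum>\<beta>\<^sub>3\<in>arcs_from_to G k i\<^sub>3. \<Sum>\<beta>\<^sub>4\<in>arcs_from_to G i\<^sub>4 k.
          of_real (inverse (\<phi> k)) * W \<alpha>\<^sub>1 \<beta>\<^sub>1 \<beta>\<^sub>2 * cnj (W \<alpha>\<^sub>2 \<beta>\<^sub>1 \<beta>\<^sub>3) *
          W \<alpha>\<^sub>3 \<beta>\<^sub>4 \<beta>\<^sub>3 * cnj (W \<alpha>\<^sub>4 \<beta>\<^sub>4 \<beta>\<^sub>2))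
       = of_bool (\<alpha>\<^sub>1 = \<alpha>\<^sub>4) * of_bool (\<alpha>\<^sub>2 = \<alpha>\<^sub>3) * of_real (\<phi> i\<^sub>1 * \<phi> i\<^sub>2 * \<phi> i\<^sub>3)
       + of_bool (\<alpha>\<^sub>1 = \<alpha>\<^sub>2) * of_bool (\<alpha>\<^sub>3 = \<alpha>\<^sub>4) * of_real (\<phi> i\<^sub>1 * \<phi> i\<^sub>2 * \<phi> i\<^sub>4)"

definition unitary_on :: "'b set \<Rightarrow> ('b \<Rightarrow> 'b \<Rightarrow> complex) \<Rightarrow> bool" where
  "unitary_on S u \<longleftrightarrow>
     (\<forall>\<sigma>\<in>S. \<forall>\<sigma>'\<in>S. (\<Sum>\<tau>\<in>S. u \<sigma> \<tau> * cnj (u \<sigma>' \<tau>)) = of_bool (\<sigma> = \<sigma>')) \<and>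
     (\<forall>\<sigma>\<in>S. \<forall>\<sigma>'\<in>S. (\<Sum>\<tau>\<in>S. cnj (u \<tau> \<sigma>) * u \<tau> \<sigma>') = of_bool (\<sigma> = \<sigma>'))"

text \<open>
  \<open>u i j\<close> is the matrix for the ordered pair \<open>(i, j)\<close>; the matrices for \<open>(i, j)\<close> and \<open>(j, i)\<close> are
  independent. For a pair without arcs the unitarity condition is vacuous.
\<close>

definition cell_equiv ::
  "('a, 'b) pre_digraph \<Rightarrow> ('b \<Rightarrow> 'b \<Rightarrow> 'b \<Rightarrow> complex) \<Rightarrow> ('b \<Rightarrow> 'b \<Rightarrow> 'b \<Rightarrow> complex) \<Rightarrow> bool"
where
  "cell_equiv G W\<^sub>1 W\<^sub>2 \<longleftrightarrow>
     (\<exists>u :: 'a \<Rightarrow> 'a \<Rightarrow> 'b \<Rightarrow> 'b \<Rightarrow> complex.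
        (\<forall>i\<in>verts G. \<forall>j\<in>verts G. unitary_on (arcs_from_to G i j) (u i j)) \<and>
        (\<forall>i\<in>verts G. \<forall>j\<in>verts G. \<forall>k\<in>verts G.
         \<forall>\<sigma>\<in>arcs_from_to G i j. \<forall>\<rho>\<in>arcs_from_to G j k. \<forall>\<gamma>\<in>arcs_from_to G k i.
           W\<^sub>1 \<sigma> \<rho> \<gamma> =
             (\<Sum>\<sigma>'\<in>arcs_from_to G i j. \<Sum>\<rho>'\<in>arcs_from_to G j k. \<Sum>\<gamma>'\<in>arcs_from_to G k i.
                u i j \<sigma> \<sigma>' * u j k \<rho> \<rho>' * u k i \<gamma> \<gamma>' * W\<^sub>2 \<sigma>' \<rho>' \<gamma>')))"

text \<open>The graph has no multiple edges, so an edge is encoded as its (source, range) pair.\<close>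

definition A_star :: "nat \<Rightarrow> (nat, nat \<times> nat) pre_digraph" where
  "A_star n = \<lparr>verts = {1..n},
     arcs = {(i, i + 1) | i. 1 \<le> i \<and> i \<le> n - 1} \<union> {(i + 1, i) | i. 1 \<le> i \<and> i \<le> n - 1}
          \<union> {(i, i) | i. 2 \<le> i \<and> i \<le> n},
     tail = fst, head = snd\<rparr>"

definition A_star_vec :: "nat \<Rightarrow> nat \<Rightarrow> real" where
  "A_star_vec n i = qint (2 * n + 1) (2 * i - 1)"

definition cell :: "(nat \<times> nat \<Rightarrow> nat \<times> nat \<Rightarrow> nat \<times> nat \<Rightarrow> complex) \<Rightarrow> nat \<Rightarrow> nat \<Rightarrow> nat \<Rightarrow> complex" where
  "cell W a b c = W (a, b) (b, c) (c, a)"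

end

theory Submission
  imports Defs
begin

text \<open>
  As the graph has no multiple edges, a triangle is a closed walk of three vertices; these are pairwise adjacent, so up
  to rotation it is $m, m+1, m+1$ or $m, m, m+1$ or $m, m, m$. A cell system therefore consists of three sequences of
  complex numbers, and \<open>cell_system_A_star_iff\<close> rewrites its equations as sums over vertices.

  Existence. The proposed cells are real and symmetric in the vertices, and both sides of the type II
  equation are then invariant under the symmetries of a closed walk of length four. Up to these there are six shapes of
  walks (\<open>closed_walk_cases\<close>). Since $[2m-1] = [m]^2 - [m-1]^2$ and $[m-1][m+1] = [m]^2 - 1$, all equations
  turn into polynomial identities between consecutive quantum integers (\<open>star_cell_type_I\<close>, \<open>type_II_lhs_star_cell\<close>).
  The formulas vanish on the triangles that are missing at the ends of the path, because $[0] = [2n+1] = 0$.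
  The signs of the cells $W_{i,i,i}$ are needed for the walk $m, m, m+1, m+1$, whose two contributions have to cancel.

  Uniqueness. Going up the path, the type I equations and the type II equation on $m, m+1, m+2, m+1$, whose sum has only
  one term, determine all moduli successively (\<open>moduli_unique\<close>, \<open>loop_moduli_unique\<close>), so two cell systems differ
  by phases. The type II equation on $m+1, m+1, m, m$ links the phases of the loop cells at
  neighbouring vertices (\<open>phase_recursion\<close>), and this is exactly the compatibility condition for absorbing all phases
  into phases of the edges (\<open>cell_equiv_A_star\<close>).
\<close>

section \<open>Quantum integers at a root of unity\<close>

lemma qint_sin: "qint h m = sin (real m * (pi / h)) / sin (pi / h)"
proof -
  have q: "qroot h = cis (pi / h)"
    by (simp add: qroot_def cis_conv_exp)
  have p: "cis t - inverse (cis t) = 2 * \<i> * of_real (sin t)" for t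
    by (simp add: complex_eq_iff)
  have "qroot h ^ m - inverse (qroot h) ^ m = 2 * \<i> * of_real (sin (real m * (pi / h)))"
    using p[of "real m * (pi / h)"] by (simp only: q power_inverse Complex.DeMoivre)
  moreover have "qroot h - inverse (qroot h) = 2 * \<i> * of_real (sin (pi / h))"
    unfolding q by (rule p)
  ultimately have "(qroot h ^ m - inverse (qroot h) ^ m) / (qroot h - inverse (qroot h))
      = of_real (sin (real m * (pi / h)) / sin (pi / h))"
    by simp
  then show ?thesis
    unfolding qint_def by (metis Re_complex_of_real)
qed

lemma qint_0 [simp]: "qint h 0 = 0"
  by (simp add: qint_sin)

lemma qint_pos: "0 < m \<Longrightarrow> m < h \<Longrightarrow> 0 < qint h m"
  unfolding qint_sin
  by (intro divide_pos_pos sin_gt_zero) (auto simp: field_simps)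

lemma qint_self [simp]: "qint h h = 0"
  by (simp add: qint_sin)

lemma sin_unit_pos: "2 \<le> h \<Longrightarrow> 0 < sin (pi / real h)"
  by (intro sin_gt_zero) (auto simp: field_simps)

lemma qint_1: "2 \<le> h \<Longrightarrow> qint h 1 = 1"
  using sin_unit_pos[of h] by (simp add: qint_sin)

lemma sin_add_mult_sin_diff: "sin (x + y) * sin (x - y) = (sin x)\<^sup>2 - (sin y)\<^sup>2" for x y :: real
proof -
  have "sin (x + y) * sin (x - y) = (sin x)\<^sup>2 * (cos y)\<^sup>2 - (cos x)\<^sup>2 * (sin y)\<^sup>2"
    by (simp add: sin_add sin_diff power2_eq_square algebra_simps)
  then show ?thesis
    by (simp add: cos_squared_eq algebra_simps)
qed

text \<open>
  The instance \<open>m = 1\<close> gives $[k-1][k+1] = [k]^2 - 1$, and two consecutive arguments give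
  $[2m+1] = [m+1]^2 - [m]^2$, which expresses the eigenvector entries by squares.
\<close>

lemma qint_add_mult_diff:
  assumes "m \<le> k"
  shows "qint h (k + m) * qint h (k - m) = (qint h k)\<^sup>2 - (qint h m)\<^sup>2"
proof -
  let ?t = "pi / real h"
  have "sin (real (k + m) * ?t) * sin (real (k - m) * ?t) = (sin (real k * ?t))\<^sup>2 - (sin (real m * ?t))\<^sup>2"
    unfolding sin_add_mult_sin_diff[symmetric] of_nat_diff[OF assms] of_nat_add distrib_right left_diff_distrib ..
  then show ?thesis
    by (simp add: qint_sin power2_eq_square diff_divide_distrib[symmetric])
qed

lemma qint_2_mult:
  assumes "2 \<le> h"
  shows "qint h 2 * qint h (Suc i) = qint h i + qint h (Suc (Suc i))"
proof -
  define t where "t = pi / real h"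
  have "sin (real (Suc i) * t - t) + sin (real (Suc i) * t + t) = 2 * cos t * sin (real (Suc i) * t)"
    by (simp add: sin_diff sin_add del: of_nat_Suc)
  moreover have "real (Suc i) * t - t = real i * t" "real (Suc i) * t + t = real (Suc (Suc i)) * t"
    by (simp_all add: distrib_right)
  moreover have "sin t \<noteq> 0"
    using sin_unit_pos[OF assms] by (simp add: t_def)
  moreover have "sin (2 * t) = 2 * sin t * cos t"
    by (rule sin_double)
  ultimately show ?thesis
    unfolding qint_sin t_def[symmetric]
    by (simp only: of_nat_numeral add_divide_distrib[symmetric]) simp
qed

lemma qint_3_mult:
  assumes "2 \<le> h"
  shows "qint h 3 * qint h (Suc (Suc i)) = qint h i + qint h (Suc (Suc i)) + qint h (Suc (Suc (Suc (Suc i))))"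
proof -
  have "qint h 2 * qint h 2 = 1 + qint h 3"
    using qint_2_mult[OF assms, of 1] qint_1[OF assms] by (simp add: numeral_2_eq_2 numeral_3_eq_3)
  then show ?thesis
    using qint_2_mult[OF assms, of i] qint_2_mult[OF assms, of "Suc i"] qint_2_mult[OF assms, of "Suc (Suc i)"]
    by algebra
qed

section \<open>The graph and its Perron-Frobenius eigenvector\<close>

definition adj :: "nat \<Rightarrow> nat \<Rightarrow> nat \<Rightarrow> bool" where
  "adj n i j \<longleftrightarrow> i \<in> {1..n} \<and> j \<in> {1..n} \<and> (j = Suc i \<or> i = Suc j \<or> (i = j \<and> 2 \<le> i))"

lemma adj_sym: "adj n i j \<longleftrightarrow> adj n j i"
  by (auto simp: adj_def)

lemma verts_A_star [simp]: "verts (A_star n) = {1..n}"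
  by (simp add: A_star_def)

lemma arcs_from_to_A_star: "arcs_from_to (A_star n) i j = (if adj n i j then {(i, j)} else {})"
  by (auto simp: arcs_from_to_def A_star_def adj_def)

lemma fin_digraph_A_star: "fin_digraph (A_star n)"
proof
  have "arcs (A_star n) \<subseteq> {1..n} \<times> {1..n}"
    by (auto simp: A_star_def)
  then show "finite (arcs (A_star n))"
    by (rule finite_subset) simp
qed (auto simp: A_star_def)

text \<open>
  The two ends of the path need no separate treatment as long as the summand is extended by zero to
  the missing vertices \<open>0\<close> and \<open>n + 1\<close>.
\<close>

lemma sum_neighbours:
  fixes f :: "nat \<Rightarrow> 'a::comm_monoid_add"
  assumes "1 \<le> i" and "\<And>k. k \<notin> {1..n} \<Longrightarrow> f k = 0"
    and "\<And>k. k \<notin> {i - 1, i, i + 1} \<Longrightarrow> f k = 0"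
  shows "(\<Sum>k\<in>{1..n}. f k) = f (i - 1) + f i + f (i + 1)"
proof -
  have "(\<Sum>k\<in>{1..n}. f k) = (\<Sum>k\<in>{1..n} \<union> {i - 1, i, i + 1}. f k)"
    by (rule sum.mono_neutral_left) (use assms(2) in auto)
  also have "\<dots> = (\<Sum>k\<in>{i - 1, i, i + 1}. f k)"
    by (rule sum.mono_neutral_right) (use assms(3) in auto)
  also have "\<dots> = f (i - 1) + f i + f (i + 1)"
    using assms(1) by (cases i) (simp_all add: add.assoc)
  finally show ?thesis .
qed

text \<open>
  The eigenvector equation at \<open>i\<close> is $[2i-3] + [2i-1] + [2i+1] = [3][2i-1]$; at the two ends it survives
  because $[2n+1] = 0$ and because at vertex 1 only $[3] = [3][1]$ is left. Maximality follows from
  positivity of the eigenvector: any other eigenvector $v$ is compared with it at a vertex where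
  $|v_i| / \phi_i$ is largest.
\<close>

lemma perron_frobenius_A_star:
  assumes n: "2 \<le> n"
  shows "perron_frobenius_digraph (A_star n) (2 * n + 1) (A_star_vec n)"
proof -
  let ?h = "2 * n + 1" and ?\<phi> = "A_star_vec n"
  let ?M = "\<lambda>i j. real (card (arcs_from_to (A_star n) i j))"
  have pos: "0 < ?\<phi> i" if "i \<in> {1..n}" for i
    unfolding A_star_vec_def using that by (intro qint_pos) auto
  have eig: "(\<Sum>j\<in>{1..n}. ?M i j * ?\<phi> j) = qint ?h 3 * ?\<phi> i" if i: "i \<in> {1..n}" for i
  proof -
    have "(\<Sum>j\<in>{1..n}. ?M i j * ?\<phi> j) = ?M i (i - 1) * ?\<phi> (i - 1) + ?M i i * ?\<phi> i + ?M i (i + 1) * ?\<phi> (i + 1)"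
      by (rule sum_neighbours) (use i in \<open>auto simp: arcs_from_to_A_star adj_def\<close>)
    also have "\<dots> = qint ?h 3 * ?\<phi> i"
    proof (cases "i = 1")
      case True
      then show ?thesis
        using n qint_1[of ?h] by (simp add: arcs_from_to_A_star adj_def A_star_vec_def numeral_3_eq_3)
    next
      case False
      then obtain k where k: "i = Suc (Suc k)"
        using i by (metis One_nat_def atLeastAtMost_iff not0_implies_Suc not_one_le_zero)
      \<comment> \<open>At \<open>i = n\<close> the neighbour \<open>n + 1\<close> is missing, but the entry there would be zero.\<close>
      have "?\<phi> (Suc n) = 0"
        by (simp add: A_star_vec_def)
      then have up: "?M i (Suc i) * ?\<phi> (Suc i) = ?\<phi> (Suc i)"
        using i by (cases "i = n") (auto simp: arcs_from_to_A_star adj_def)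
      show ?thesis
        using qint_3_mult[of ?h "2 * k + 1"] i up k
        by (simp add: arcs_from_to_A_star adj_def A_star_vec_def)
    qed
    finally show ?thesis .
  qed
  interpret fin_digraph "A_star n"
    by (rule fin_digraph_A_star)
  show ?thesis
  proof
    fix \<mu> :: complex and v :: "nat \<Rightarrow> complex"
    assume "\<exists>i\<in>verts (A_star n). v i \<noteq> 0"
      and ev: "\<forall>i\<in>verts (A_star n). (\<Sum>j\<in>verts (A_star n). of_nat (card (arcs_from_to (A_star n) i j)) * v j) = \<mu> * v i"
    then obtain i0 where i0: "i0 \<in> {1..n}" "v i0 \<noteq> 0"
      by auto
    let ?r = "\<lambda>j. cmod (v j) / ?\<phi> j"
    define t where "t = Max (?r ` {1..n})"
    have "t \<in> ?r ` {1..n}"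
      unfolding t_def by (rule Max_in) (use n in auto)
    then obtain i where i: "i \<in> {1..n}" "t = ?r i"
      by auto
    have t: "cmod (v j) \<le> t * ?\<phi> j" if "j \<in> {1..n}" for j
    proof -
      have "?r j \<le> t"
        unfolding t_def by (rule Max_ge) (use that in auto)
      then show ?thesis
        using pos[OF that] by (simp add: field_simps)
    qed
    have "0 < t * ?\<phi> i0"
      using t[OF i0(1)] i0(2) by (smt (verit) zero_less_norm_iff)
    then have t_pos: "0 < t"
      using pos[OF i0(1)] zero_less_mult_pos2 by blast
    have vi: "cmod (v i) = t * ?\<phi> i"
      using i pos[OF i(1)] by simp
    have "cmod \<mu> * (t * ?\<phi> i) = cmod (\<Sum>j\<in>{1..n}. of_nat (card (arcs_from_to (A_star n) i j)) * v j)"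
      using ev i(1) by (simp add: norm_mult vi)
    also have "\<dots> \<le> (\<Sum>j\<in>{1..n}. ?M i j * cmod (v j))"
      by (rule order_trans[OF norm_sum]) (simp add: norm_mult)
    also have "\<dots> \<le> (\<Sum>j\<in>{1..n}. ?M i j * (t * ?\<phi> j))"
      by (intro sum_mono mult_left_mono t) auto
    also have "\<dots> = t * (\<Sum>j\<in>{1..n}. ?M i j * ?\<phi> j)"
      by (simp add: sum_distrib_left mult_ac)
    also have "\<dots> = qint ?h 3 * (t * ?\<phi> i)"
      unfolding eig[OF i(1)] by simp
    finally show "cmod \<mu> \<le> qint ?h 3"
      using t_pos pos[OF i(1)] by simp
  qed (use pos eig in auto)
qed

lemma A_star_vec_pos: "1 \<le> i \<Longrightarrow> i \<le> n \<Longrightarrow> 0 < A_star_vec n i"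
  unfolding A_star_vec_def by (intro qint_pos) auto

lemma A_star_vec_end [simp]: "A_star_vec n (Suc n) = 0"
  by (simp add: A_star_vec_def)

lemma A_star_vec_Suc:
  "1 \<le> n \<Longrightarrow> A_star_vec n (Suc m) = (qint (2 * n + 1) (Suc m))\<^sup>2 - (qint (2 * n + 1) m)\<^sup>2"
  using qint_add_mult_diff[of m "Suc m" "2 * n + 1"] qint_1[of "2 * n + 1"]
  by (simp add: A_star_vec_def mult_2)

lemma qint_mult_Suc_Suc:
  "2 \<le> h \<Longrightarrow> qint h m * qint h (Suc (Suc m)) = (qint h (Suc m))\<^sup>2 - 1"
  using qint_add_mult_diff[of 1 "Suc m" h] qint_1[of h] by (simp add: mult.commute)

section \<open>Cell systems as functions of vertices\<close>

text \<open>
  In a graph without multiple edges a triangle is determined by its vertices. Extending cells by zero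
  off the triangles turns the sums over edges in both types of equations into sums over all vertices.
\<close>

definition tri_val :: "nat \<Rightarrow> (nat \<times> nat \<Rightarrow> nat \<times> nat \<Rightarrow> nat \<times> nat \<Rightarrow> complex) \<Rightarrow> nat \<Rightarrow> nat \<Rightarrow> nat \<Rightarrow> complex" where
  "tri_val n W a b c = (if adj n a b \<and> adj n b c \<and> adj n c a then cell W a b c else 0)"

lemma triangle_A_star:
  "triangle (A_star n) \<alpha> \<beta> \<gamma> \<longleftrightarrow>
     (\<exists>a b c. adj n a b \<and> adj n b c \<and> adj n c a \<and> \<alpha> = (a, b) \<and> \<beta> = (b, c) \<and> \<gamma> = (c, a))"
proof -
  have arcs: "e \<in> arcs (A_star n) \<longleftrightarrow> adj n (fst e) (snd e)" for e
    by (cases e) (auto simp: A_star_def adj_def)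
  have ends: "tail (A_star n) = fst" "head (A_star n) = snd"
    by (simp_all add: A_star_def)
  show ?thesis
    unfolding triangle_def arcs ends by (cases \<alpha>; cases \<beta>; cases \<gamma>) auto
qed

definition vertex_cell_system ::
  "nat \<Rightarrow> nat \<Rightarrow> (nat \<Rightarrow> real) \<Rightarrow> (nat \<Rightarrow> nat \<Rightarrow> nat \<Rightarrow> complex) \<Rightarrow> bool" where
  "vertex_cell_system n h \<phi> w \<longleftrightarrow>
     (\<forall>a b c. w a b c = w b c a) \<and>
     (\<forall>i j. adj n i j \<longrightarrow> (\<Sum>k\<in>{1..n}. (cmod (w i j k))\<^sup>2) = qint h 2 * \<phi> i * \<phi> j) \<and>
     (\<forall>i\<^sub>1 i\<^sub>2 i\<^sub>3 i\<^sub>4. adj n i\<^sub>1 i\<^sub>2 \<longrightarrow> adj n i\<^sub>3 i\<^sub>2 \<longrightarrow> adj n i\<^sub>3 i\<^sub>4 \<longrightarrow> adj n i\<^sub>1 i\<^sub>4 \<longrightarrow>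
        (\<Sum>k\<in>{1..n}. of_real (inverse (\<phi> k)) * w i\<^sub>1 i\<^sub>2 k * cnj (w i\<^sub>3 i\<^sub>2 k) * w i\<^sub>3 i\<^sub>4 k * cnj (w i\<^sub>1 i\<^sub>4 k))
        = of_bool (i\<^sub>2 = i\<^sub>4) * of_real (\<phi> i\<^sub>1 * \<phi> i\<^sub>2 * \<phi> i\<^sub>3)
        + of_bool (i\<^sub>1 = i\<^sub>3) * of_real (\<phi> i\<^sub>1 * \<phi> i\<^sub>2 * \<phi> i\<^sub>4))"

text \<open>
  Once the edges $\alpha_1, \dots, \alpha_4$ are given, the remaining edges occurring in a summand exist
  exactly when the four triangles do; in all other summands the zero extension removes the term.
\<close>

lemma cell_system_A_star_iff:
  assumes pf: "perron_frobenius_digraph (A_star n) h \<phi>"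
  shows "cell_system (A_star n) h \<phi> W \<longleftrightarrow> vertex_cell_system n h \<phi> (tri_val n W)"
proof -
  have rot: "(\<forall>\<alpha> \<beta> \<gamma>. triangle (A_star n) \<alpha> \<beta> \<gamma> \<longrightarrow> W \<alpha> \<beta> \<gamma> = W \<beta> \<gamma> \<alpha>) \<longleftrightarrow>
      (\<forall>a b c. tri_val n W a b c = tri_val n W b c a)"
  proof (intro iffI allI impI)
    fix a b c
    assume r: "\<forall>\<alpha> \<beta> \<gamma>. triangle (A_star n) \<alpha> \<beta> \<gamma> \<longrightarrow> W \<alpha> \<beta> \<gamma> = W \<beta> \<gamma> \<alpha>"
    show "tri_val n W a b c = tri_val n W b c a"
    proof (cases "adj n a b \<and> adj n b c \<and> adj n c a")
      case True
      then have "triangle (A_star n) (a, b) (b, c) (c, a)"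
        unfolding triangle_A_star by blast
      then have "W (a, b) (b, c) (c, a) = W (b, c) (c, a) (a, b)"
        using r by blast
      with True show ?thesis
        by (simp add: tri_val_def cell_def)
    next
      case False
      then have "\<not> (adj n b c \<and> adj n c a \<and> adj n a b)"
        by blast
      with False show ?thesis
        unfolding tri_val_def by (simp only: if_False)
    qed
  next
    fix \<alpha> \<beta> \<gamma>
    assume r: "\<forall>a b c. tri_val n W a b c = tri_val n W b c a"
    assume "triangle (A_star n) \<alpha> \<beta> \<gamma>"
    then obtain a b c where "adj n a b" "adj n b c" "adj n c a" and e: "\<alpha> = (a, b)" "\<beta> = (b, c)" "\<gamma> = (c, a)"
      unfolding triangle_A_star by blast
    then show "W \<alpha> \<beta> \<gamma> = W \<beta> \<gamma> \<alpha>"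
      using r[rule_format, of a b c] unfolding e by (simp add: tri_val_def cell_def)
  qed
  have I: "(\<Sum>k\<in>verts (A_star n). \<Sum>\<beta>\<in>arcs_from_to (A_star n) j k. \<Sum>\<gamma>\<in>arcs_from_to (A_star n) k i.
          W \<alpha> \<beta> \<gamma> * cnj (W \<alpha>' \<beta> \<gamma>)) = of_bool (\<alpha> = \<alpha>') * of_real (qint h 2 * \<phi> i * \<phi> j)
     \<longleftrightarrow> (\<Sum>k\<in>{1..n}. (cmod (tri_val n W i j k))\<^sup>2) = qint h 2 * \<phi> i * \<phi> j"
    if "adj n i j" "\<alpha> = (i, j)" "\<alpha>' = (i, j)" for i j \<alpha> \<alpha>'
  proof -
    have "(\<Sum>k\<in>verts (A_star n). \<Sum>\<beta>\<in>arcs_from_to (A_star n) j k. \<Sum>\<gamma>\<in>arcs_from_to (A_star n) k i.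
          W \<alpha> \<beta> \<gamma> * cnj (W \<alpha>' \<beta> \<gamma>)) = (\<Sum>k\<in>{1..n}. of_real ((cmod (tri_val n W i j k))\<^sup>2))"
      unfolding verts_A_star
      by (rule sum.cong)
        (use that in \<open>auto simp: arcs_from_to_A_star tri_val_def cell_def complex_norm_square simp del: of_real_power\<close>)
    also have "\<dots> = of_real (\<Sum>k\<in>{1..n}. (cmod (tri_val n W i j k))\<^sup>2)"
      by simp
    finally have eq: "(\<Sum>k\<in>verts (A_star n). \<Sum>\<beta>\<in>arcs_from_to (A_star n) j k. \<Sum>\<gamma>\<in>arcs_from_to (A_star n) k i.
          W \<alpha> \<beta> \<gamma> * cnj (W \<alpha>' \<beta> \<gamma>)) = of_real (\<Sum>k\<in>{1..n}. (cmod (tri_val n W i j k))\<^sup>2)" .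
    show ?thesis
      unfolding eq unfolding that by (simp only: simp_thms of_bool_eq mult_1 of_real_eq_iff)
  qed
  have II: "(\<Sum>k\<in>verts (A_star n). \<Sum>\<beta>\<^sub>1\<in>arcs_from_to (A_star n) i\<^sub>2 k. \<Sum>\<beta>\<^sub>2\<in>arcs_from_to (A_star n) k i\<^sub>1.
        \<Sum>\<beta>\<^sub>3\<in>arcs_from_to (A_star n) k i\<^sub>3. \<Sum>\<beta>\<^sub>4\<in>arcs_from_to (A_star n) i\<^sub>4 k.
          of_real (inverse (\<phi> k)) * W (i\<^sub>1, i\<^sub>2) \<beta>\<^sub>1 \<beta>\<^sub>2 * cnj (W (i\<^sub>3, i\<^sub>2) \<beta>\<^sub>1 \<beta>\<^sub>3) *
          W (i\<^sub>3, i\<^sub>4) \<beta>\<^sub>4 \<beta>\<^sub>3 * cnj (W (i\<^sub>1, i\<^sub>4) \<beta>\<^sub>4 \<beta>\<^sub>2))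
     = (\<Sum>k\<in>{1..n}. of_real (inverse (\<phi> k)) * tri_val n W i\<^sub>1 i\<^sub>2 k * cnj (tri_val n W i\<^sub>3 i\<^sub>2 k) *
          tri_val n W i\<^sub>3 i\<^sub>4 k * cnj (tri_val n W i\<^sub>1 i\<^sub>4 k))"
    if "adj n i\<^sub>1 i\<^sub>2" "adj n i\<^sub>3 i\<^sub>2" "adj n i\<^sub>3 i\<^sub>4" "adj n i\<^sub>1 i\<^sub>4" for i\<^sub>1 i\<^sub>2 i\<^sub>3 i\<^sub>4
    unfolding verts_A_star
    by (rule sum.cong)
      (use that in \<open>auto simp: arcs_from_to_A_star tri_val_def cell_def adj_sym\<close>)
  have adjD: "i \<in> {1..n} \<and> j \<in> {1..n}" if "adj n i j" for i j
    using that by (simp add: adj_def)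
  show ?thesis
  proof
    assume "cell_system (A_star n) h \<phi> W"
    then interpret cell_system "A_star n" h \<phi> W .
    show "vertex_cell_system n h \<phi> (tri_val n W)"
      unfolding vertex_cell_system_def
    proof (intro conjI allI impI)
      show "tri_val n W a b c = tri_val n W b c a" for a b c
        using rot rotation by blast
    next
      fix i j assume a: "adj n i j"
      show "(\<Sum>k\<in>{1..n}. (cmod (tri_val n W i j k))\<^sup>2) = qint h 2 * \<phi> i * \<phi> j"
        using type_I[of i j "(i, j)" "(i, j)"] I[OF a refl refl] a adjD[OF a]
        by (simp add: arcs_from_to_A_star)
    next
      fix i\<^sub>1 i\<^sub>2 i\<^sub>3 i\<^sub>4
      assume a: "adj n i\<^sub>1 i\<^sub>2" "adj n i\<^sub>3 i\<^sub>2" "adj n i\<^sub>3 i\<^sub>4" "adj n i\<^sub>1 i\<^sub>4"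
      note t = type_II[of i\<^sub>1 i\<^sub>2 i\<^sub>3 i\<^sub>4 "(i\<^sub>1, i\<^sub>2)" "(i\<^sub>3, i\<^sub>2)" "(i\<^sub>3, i\<^sub>4)" "(i\<^sub>1, i\<^sub>4)", unfolded II[OF a]]
      show "(\<Sum>k\<in>{1..n}. of_real (inverse (\<phi> k)) * tri_val n W i\<^sub>1 i\<^sub>2 k * cnj (tri_val n W i\<^sub>3 i\<^sub>2 k) *
          tri_val n W i\<^sub>3 i\<^sub>4 k * cnj (tri_val n W i\<^sub>1 i\<^sub>4 k))
        = of_bool (i\<^sub>2 = i\<^sub>4) * of_real (\<phi> i\<^sub>1 * \<phi> i\<^sub>2 * \<phi> i\<^sub>3)
        + of_bool (i\<^sub>1 = i\<^sub>3) * of_real (\<phi> i\<^sub>1 * \<phi> i\<^sub>2 * \<phi> i\<^sub>4)"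
        by (rule trans[OF t]) (use a adjD[OF a(1)] adjD[OF a(3)] in \<open>auto simp: arcs_from_to_A_star\<close>)
    qed
  next
    assume v: "vertex_cell_system n h \<phi> (tri_val n W)"
    interpret perron_frobenius_digraph "A_star n" h \<phi>
      by (rule pf)
    show "cell_system (A_star n) h \<phi> W"
    proof
      show "triangle (A_star n) \<alpha> \<beta> \<gamma> \<Longrightarrow> W \<alpha> \<beta> \<gamma> = W \<beta> \<gamma> \<alpha>" for \<alpha> \<beta> \<gamma>
        using rot v unfolding vertex_cell_system_def by blast
    next
      fix i j \<alpha> \<alpha>'
      assume "\<alpha> \<in> arcs_from_to (A_star n) i j" "\<alpha>' \<in> arcs_from_to (A_star n) i j"
      then have a: "adj n i j" "\<alpha> = (i, j)" "\<alpha>' = (i, j)"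
        by (auto simp: arcs_from_to_A_star split: if_splits)
      show "(\<Sum>k\<in>verts (A_star n). \<Sum>\<beta>\<in>arcs_from_to (A_star n) j k. \<Sum>\<gamma>\<in>arcs_from_to (A_star n) k i.
          W \<alpha> \<beta> \<gamma> * cnj (W \<alpha>' \<beta> \<gamma>)) = of_bool (\<alpha> = \<alpha>') * of_real (qint h 2 * \<phi> i * \<phi> j)"
        unfolding I[OF a] using v a(1) unfolding vertex_cell_system_def by blast
    next
      fix i\<^sub>1 i\<^sub>2 i\<^sub>3 i\<^sub>4 \<alpha>\<^sub>1 \<alpha>\<^sub>2 \<alpha>\<^sub>3 \<alpha>\<^sub>4
      assume "\<alpha>\<^sub>1 \<in> arcs_from_to (A_star n) i\<^sub>1 i\<^sub>2" "\<alpha>\<^sub>2 \<in> arcs_from_to (A_star n) i\<^sub>3 i\<^sub>2"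
        "\<alpha>\<^sub>3 \<in> arcs_from_to (A_star n) i\<^sub>3 i\<^sub>4" "\<alpha>\<^sub>4 \<in> arcs_from_to (A_star n) i\<^sub>1 i\<^sub>4"
      then have a: "adj n i\<^sub>1 i\<^sub>2" "adj n i\<^sub>3 i\<^sub>2" "adj n i\<^sub>3 i\<^sub>4" "adj n i\<^sub>1 i\<^sub>4"
        and \<alpha>: "\<alpha>\<^sub>1 = (i\<^sub>1, i\<^sub>2)" "\<alpha>\<^sub>2 = (i\<^sub>3, i\<^sub>2)" "\<alpha>\<^sub>3 = (i\<^sub>3, i\<^sub>4)" "\<alpha>\<^sub>4 = (i\<^sub>1, i\<^sub>4)"
        by (auto simp: arcs_from_to_A_star split: if_splits)
      have r: "of_bool (\<alpha>\<^sub>1 = \<alpha>\<^sub>4) * of_bool (\<alpha>\<^sub>2 = \<alpha>\<^sub>3) * of_real (\<phi> i\<^sub>1 * \<phi> i\<^sub>2 * \<phi> i\<^sub>3)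
       + of_bool (\<alpha>\<^sub>1 = \<alpha>\<^sub>2) * of_bool (\<alpha>\<^sub>3 = \<alpha>\<^sub>4) * of_real (\<phi> i\<^sub>1 * \<phi> i\<^sub>2 * \<phi> i\<^sub>4)
       = of_bool (i\<^sub>2 = i\<^sub>4) * of_real (\<phi> i\<^sub>1 * \<phi> i\<^sub>2 * \<phi> i\<^sub>3)
        + of_bool (i\<^sub>1 = i\<^sub>3) * (of_real (\<phi> i\<^sub>1 * \<phi> i\<^sub>2 * \<phi> i\<^sub>4) :: complex)"
        unfolding \<alpha> by auto
      show "(\<Sum>k\<in>verts (A_star n). \<Sum>\<beta>\<^sub>1\<in>arcs_from_to (A_star n) i\<^sub>2 k. \<Sum>\<beta>\<^sub>2\<in>arcs_from_to (A_star n) k i\<^sub>1.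
        \<Sum>\<beta>\<^sub>3\<in>arcs_from_to (A_star n) k i\<^sub>3. \<Sum>\<beta>\<^sub>4\<in>arcs_from_to (A_star n) i\<^sub>4 k.
          of_real (inverse (\<phi> k)) * W \<alpha>\<^sub>1 \<beta>\<^sub>1 \<beta>\<^sub>2 * cnj (W \<alpha>\<^sub>2 \<beta>\<^sub>1 \<beta>\<^sub>3) *
          W \<alpha>\<^sub>3 \<beta>\<^sub>4 \<beta>\<^sub>3 * cnj (W \<alpha>\<^sub>4 \<beta>\<^sub>4 \<beta>\<^sub>2))
       = of_bool (\<alpha>\<^sub>1 = \<alpha>\<^sub>4) * of_bool (\<alpha>\<^sub>2 = \<alpha>\<^sub>3) * of_real (\<phi> i\<^sub>1 * \<phi> i\<^sub>2 * \<phi> i\<^sub>3)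
       + of_bool (\<alpha>\<^sub>1 = \<alpha>\<^sub>2) * of_bool (\<alpha>\<^sub>3 = \<alpha>\<^sub>4) * of_real (\<phi> i\<^sub>1 * \<phi> i\<^sub>2 * \<phi> i\<^sub>4)"
        unfolding r unfolding \<alpha> II[OF a] using v a unfolding vertex_cell_system_def by blast
    qed
  qed
qed

section \<open>The explicit cells\<close>

text \<open>
  \<open>upper_cell n i\<close> is the value on $i-1, i, i$ (loop at the upper vertex), \<open>lower_cell n i\<close> the value on $i, i, i+1$
  (loop at the lower vertex) and \<open>loop_cell n i\<close> the value on $i, i, i$.
\<close>

definition upper_cell :: "nat \<Rightarrow> nat \<Rightarrow> real" where
  "upper_cell n i = sqrt (qint (2 * n + 1) i * qint (2 * n + 1) (2 * i - 3) * qint (2 * n + 1) (2 * i - 1))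
                / sqrt (qint (2 * n + 1) (i - 1))"

definition lower_cell :: "nat \<Rightarrow> nat \<Rightarrow> real" where
  "lower_cell n i = sqrt (qint (2 * n + 1) (i - 1) * qint (2 * n + 1) (2 * i - 1) * qint (2 * n + 1) (2 * i + 1))
                / sqrt (qint (2 * n + 1) i)"

definition loop_cell :: "nat \<Rightarrow> nat \<Rightarrow> real" where
  "loop_cell n i = (-1) ^ (i + 1) * (qint (2 * n + 1) (2 * i - 1)
                / sqrt (qint (2 * n + 1) (i - 1) * qint (2 * n + 1) i))"

text \<open>
  With the index shifted by one, the cells are expressed by $[m]$, $[m+1]$ and the eigenvector entries, and truncated
  subtraction disappears.
\<close>

lemma upper_cell_Suc:
  "upper_cell n (Suc m) = sqrt (qint (2 * n + 1) (Suc m) * A_star_vec n m * A_star_vec n (Suc m) / qint (2 * n + 1) m)"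
  by (simp add: upper_cell_def A_star_vec_def real_sqrt_divide numeral_3_eq_3)

lemma lower_cell_Suc:
  "lower_cell n (Suc m) =
     sqrt (qint (2 * n + 1) m * A_star_vec n (Suc m) * A_star_vec n (Suc (Suc m)) / qint (2 * n + 1) (Suc m))"
  by (simp add: lower_cell_def A_star_vec_def real_sqrt_divide)

lemma loop_cell_Suc:
  "loop_cell n (Suc m) =
     (-1) ^ m * A_star_vec n (Suc m) / sqrt (qint (2 * n + 1) m * qint (2 * n + 1) (Suc m))"
  by (simp add: loop_cell_def A_star_vec_def)

lemma A_star_vec_nonneg: "1 \<le> i \<Longrightarrow> i \<le> Suc n \<Longrightarrow> 0 \<le> A_star_vec n i"
  using A_star_vec_pos[of i n] by (cases "i = Suc n") auto

lemma qint_odd_pos: "1 \<le> m \<Longrightarrow> m \<le> Suc n \<Longrightarrow> 1 \<le> n \<Longrightarrow> 0 < qint (2 * n + 1) m"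
  by (intro qint_pos) auto

lemma upper_cell_sq:
  assumes "1 \<le> m" "m < n"
  shows "(upper_cell n (Suc m))\<^sup>2 = qint (2 * n + 1) (Suc m) * A_star_vec n m * A_star_vec n (Suc m) / qint (2 * n + 1) m"
  unfolding upper_cell_Suc
  by (intro real_sqrt_pow2 divide_nonneg_nonneg mult_nonneg_nonneg A_star_vec_nonneg less_imp_le[OF qint_odd_pos])
    (use assms in auto)

text \<open>
  At the ends of the path the formulas produce the value zero of the absent triangles: $[0] = 0$
  for the lower cell and, through division by $0$, for the loop at vertex 1, and $[2n+1] = 0$ for the lower
  cell at \<open>n\<close>. Hence no end of the path is exceptional in the sums below.
\<close>

lemma lower_cell_1 [simp]: "lower_cell n (Suc 0) = 0"
  by (simp add: lower_cell_Suc)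

lemma loop_cell_1 [simp]: "loop_cell n (Suc 0) = 0"
  by (simp add: loop_cell_Suc)

lemma lower_cell_end [simp]: "lower_cell n n = 0"
  by (simp add: lower_cell_def)

lemma lower_cell_sq:
  assumes "Suc m \<le> n"
  shows "(lower_cell n (Suc m))\<^sup>2 =
     qint (2 * n + 1) m * A_star_vec n (Suc m) * A_star_vec n (Suc (Suc m)) / qint (2 * n + 1) (Suc m)"
proof (cases "m = 0")
  case False
  then show ?thesis
    unfolding lower_cell_Suc
    by (intro real_sqrt_pow2 divide_nonneg_nonneg mult_nonneg_nonneg A_star_vec_nonneg less_imp_le[OF qint_odd_pos])
      (use assms in auto)
qed simp

lemma loop_cell_sq:
  assumes "1 \<le> m" "m < n"
  shows "(loop_cell n (Suc m))\<^sup>2 = (A_star_vec n (Suc m))\<^sup>2 / (qint (2 * n + 1) m * qint (2 * n + 1) (Suc m))"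
proof -
  have "0 < qint (2 * n + 1) m" "0 < qint (2 * n + 1) (Suc m)"
    using assms by (auto intro!: qint_pos)
  then show ?thesis
    by (simp add: loop_cell_Suc power_divide power_mult_distrib power_mult[symmetric] mult.commute)
qed

text \<open>
  This and the following lemma give the two summands of the type II equation on $m, m, m+1, m+1$. At a common
  edge they have the same modulus, and the sign $(-1)^{i+1}$ of the loop cell makes them cancel.
\<close>

lemma loop_cell_upper_cell:
  assumes "1 \<le> m" "m < n"
  shows "loop_cell n (Suc m) * upper_cell n (Suc m) / A_star_vec n (Suc m) =
    (-1) ^ m * sqrt (A_star_vec n m * A_star_vec n (Suc m)) / qint (2 * n + 1) m"
proof -
  have p: "0 < qint (2 * n + 1) m" "0 < qint (2 * n + 1) (Suc m)" "0 < A_star_vec n (Suc m)"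
    using assms by (auto intro!: qint_pos A_star_vec_pos)
  then show ?thesis
    by (simp add: loop_cell_Suc upper_cell_Suc real_sqrt_mult real_sqrt_divide field_simps)
qed

lemma loop_cell_lower_cell:
  assumes "1 \<le> m" "m < n"
  shows "loop_cell n (Suc m) * lower_cell n (Suc m) / A_star_vec n (Suc m) =
    (-1) ^ m * sqrt (A_star_vec n (Suc m) * A_star_vec n (Suc (Suc m))) / qint (2 * n + 1) (Suc m)"
proof -
  have p: "0 < qint (2 * n + 1) m" "0 < qint (2 * n + 1) (Suc m)" "0 < A_star_vec n (Suc m)"
    using assms by (auto intro!: qint_pos A_star_vec_pos)
  then show ?thesis
    by (simp add: loop_cell_Suc lower_cell_Suc real_sqrt_mult real_sqrt_divide field_simps)
qed

text \<open>
  All cells as one function of the three vertices. It is symmetric in its arguments and vanishes as soon as two of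
  them differ by more than one, so it is defined by the smallest vertex, the largest vertex and, between these, by which
  of the two occurs twice.
\<close>

definition star_cell :: "nat \<Rightarrow> nat \<Rightarrow> nat \<Rightarrow> nat \<Rightarrow> real" where
  "star_cell n a b c =
     (let lo = min a (min b c); hi = max a (max b c) in
        if hi = lo then loop_cell n lo
        else if hi = Suc lo then (if a + b + c = 3 * lo + 1 then lower_cell n lo else upper_cell n hi)
        else 0)"

lemma star_cell_swap: "star_cell n a b c = star_cell n b a c"
  by (simp add: star_cell_def Let_def min.left_commute max.left_commute add.commute)

lemma star_cell_rotate: "star_cell n a b c = star_cell n b c a"
  by (simp add: star_cell_def Let_def min.commute min.left_commute max.commute max.left_commute add_ac)

lemma star_cell_simps [simp]:
  "star_cell n i i i = loop_cell n i"
  "star_cell n i i (Suc i) = lower_cell n i" "star_cell n i (Suc i) i = lower_cell n i" "star_cell n (Suc i) i i = lower_cell n i"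
  "star_cell n i (Suc i) (Suc i) = upper_cell n (Suc i)" "star_cell n (Suc i) i (Suc i) = upper_cell n (Suc i)"
  "star_cell n (Suc i) (Suc i) i = upper_cell n (Suc i)"
  by (simp_all add: star_cell_def)

lemma star_cell_far: "Suc a < c \<or> Suc c < a \<Longrightarrow> star_cell n a b c = 0"
  by (auto simp: star_cell_def Let_def min_def max_def)

lemma star_cell_far': "Suc b < c \<or> Suc c < b \<Longrightarrow> star_cell n a b c = 0"
  using star_cell_far[of b c n a] by (simp add: star_cell_swap)

lemma star_cell_outside:
  assumes "adj n i j" "k \<notin> {1..n}"
  shows "star_cell n i j k = 0"
proof (cases "Suc i < k \<or> Suc k < i \<or> Suc j < k \<or> Suc k < j")
  case True
  then show ?thesis using star_cell_far star_cell_far' by blast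
next
  case False
  then have "k = Suc n" "i = n" "j = n"
    using assms by (auto simp: adj_def)
  then show ?thesis by simp
qed

lemma sum_star_cell:
  assumes "adj n i j"
  shows "(\<Sum>k\<in>{1..n}. star_cell n i j k * g k) =
    star_cell n i j (i - 1) * g (i - 1) + star_cell n i j i * g i + star_cell n i j (i + 1) * g (i + 1)"
  by (rule sum_neighbours) (use assms in \<open>auto simp: adj_def star_cell_outside intro!: star_cell_far\<close>)

definition star_cells :: "nat \<Rightarrow> nat \<times> nat \<Rightarrow> nat \<times> nat \<Rightarrow> nat \<times> nat \<Rightarrow> complex" where
  "star_cells n \<alpha> \<beta> \<gamma> = of_real (star_cell n (fst \<alpha>) (fst \<beta>) (fst \<gamma>))"

lemma cell_star_cells [simp]: "cell (star_cells n) a b c = of_real (star_cell n a b c)"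
  by (simp add: cell_def star_cells_def)

text \<open>
  The only triples of neighbours that are not triangles contain two consecutive entries 1, where the
  loop is missing; there the formula gives zero anyway.
\<close>

lemma tri_val_star_cells:
  assumes "adj n a b" "k \<in> {1..n}"
  shows "tri_val n (star_cells n) a b k = of_real (star_cell n a b k)"
proof (cases "adj n b k \<and> adj n k a")
  case True
  then show ?thesis using assms by (simp add: tri_val_def)
next
  case False
  show ?thesis
  proof (cases "Suc a < k \<or> Suc k < a \<or> Suc b < k \<or> Suc k < b")
    case True
    then have "star_cell n a b k = 0"
      using star_cell_far star_cell_far' by blast
    then show ?thesis by (simp add: tri_val_def)
  next
    case near: False
    have one: "x = 1 \<and> y = 1" if "x \<in> {1..n}" "y \<in> {1..n}" "\<not> adj n x y" "x \<le> Suc y" "y \<le> Suc x" for x y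
      using that by (auto simp: adj_def)
    have "a \<in> {1..n}" "b \<in> {1..n}"
      using assms(1) by (simp_all add: adj_def)
    then have "b = 1 \<and> k = 1 \<or> k = 1 \<and> a = 1"
      using False near one[of b k] one[of k a] assms(2) by (meson not_less)
    then have "(a, b, k) = (2, 1, 1) \<or> (a, b, k) = (1, 2, 1)"
      using assms(1) by (auto simp: adj_def)
    then have "star_cell n a b k = 0"
      by (elim disjE) (simp_all add: numeral_2_eq_2)
    then show ?thesis by (simp add: tri_val_def)
  qed
qed

text \<open>
  For an edge the equation is $[m-1] + [m+1] = [2][m]$. For a loop it becomes, with $x = [m]$, $y = [m+1]$,
  $w = [m-1]$, $z = [m+2]$, a polynomial identity modulo $wy = x^2 - 1$, $xz = y^2 - 1$ and $x + z = [2]y$.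
\<close>

lemma star_cell_type_I:
  assumes n: "2 \<le> n" and a: "adj n i j"
  shows "(\<Sum>k\<in>{1..n}. (star_cell n i j k)\<^sup>2) = qint (2 * n + 1) 2 * A_star_vec n i * A_star_vec n j"
proof -
  let ?S = "\<lambda>i j. \<Sum>k\<in>{1..n}. (star_cell n i j k)\<^sup>2"
  let ?q = "qint (2 * n + 1)" and ?\<phi> = "A_star_vec n"
  have S: "?S i j = (star_cell n i j (i - 1))\<^sup>2 + (star_cell n i j i)\<^sup>2 + (star_cell n i j (i + 1))\<^sup>2"
    if "adj n i j" for i j
    using sum_star_cell[OF that, of "\<lambda>k. star_cell n i j k"] by (simp add: power2_eq_square)
  have edge: "?S (Suc m) (Suc (Suc m)) = ?q 2 * ?\<phi> (Suc m) * ?\<phi> (Suc (Suc m))"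
    if m: "Suc m < n" for m
  proof -
    have "?S (Suc m) (Suc (Suc m)) = (lower_cell n (Suc m))\<^sup>2 + (upper_cell n (Suc (Suc m)))\<^sup>2"
      using m by (subst S) (auto simp: adj_def star_cell_far')
    also have "\<dots> = (?q m + ?q (Suc (Suc m))) * ?\<phi> (Suc m) * ?\<phi> (Suc (Suc m)) / ?q (Suc m)"
      using m by (subst lower_cell_sq upper_cell_sq; simp)+ (simp add: field_simps add_divide_distrib)
    also have "\<dots> = ?q 2 * ?\<phi> (Suc m) * ?\<phi> (Suc (Suc m))"
      using qint_odd_pos[of "Suc m" n] m qint_2_mult[of "2 * n + 1" m] by (simp add: field_simps)
    finally show ?thesis .
  qed
  have loop: "?S (Suc m) (Suc m) = ?q 2 * ?\<phi> (Suc m) * ?\<phi> (Suc m)"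
    if m: "1 \<le> m" "m < n" for m
  proof -
    obtain l where l: "m = Suc l"
      using m by (cases m) auto
    define x y w z where "x = ?q m" and "y = ?q (Suc m)" and "w = ?q l" and "z = ?q (Suc (Suc m))"
    have pos: "x \<noteq> 0" "y \<noteq> 0"
      using qint_odd_pos[of m n] qint_odd_pos[of "Suc m" n] m by (auto simp: x_def y_def)
    have rel: "w * y = x\<^sup>2 - 1" "x * z = y\<^sup>2 - 1" "?q 2 * y = x + z"
      using qint_mult_Suc_Suc[of "2 * n + 1" l] qint_mult_Suc_Suc[of "2 * n + 1" m] qint_2_mult[of "2 * n + 1" m] n
      by (simp_all add: x_def y_def w_def z_def l)
    have \<phi>: "?\<phi> m = x\<^sup>2 - w\<^sup>2" "?\<phi> (Suc m) = y\<^sup>2 - x\<^sup>2" "?\<phi> (Suc (Suc m)) = z\<^sup>2 - y\<^sup>2"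
      using n A_star_vec_Suc[of n l] A_star_vec_Suc[of n m] A_star_vec_Suc[of n "Suc m"]
      by (simp_all add: x_def y_def w_def z_def l)
    have "?S (Suc m) (Suc m) = (upper_cell n (Suc m))\<^sup>2 + (loop_cell n (Suc m))\<^sup>2 + (lower_cell n (Suc m))\<^sup>2"
      using m by (subst S) (auto simp: adj_def)
    also have "\<dots> = y * (x\<^sup>2 - w\<^sup>2) * (y\<^sup>2 - x\<^sup>2) / x + (y\<^sup>2 - x\<^sup>2)\<^sup>2 / (x * y)
        + x * (y\<^sup>2 - x\<^sup>2) * (z\<^sup>2 - y\<^sup>2) / y"
      using upper_cell_sq[OF m] lower_cell_sq[of m n] loop_cell_sq[OF m] m unfolding \<phi> x_def y_def by simp
    also have "\<dots> = (y\<^sup>2 - x\<^sup>2) * (y\<^sup>2 * (x\<^sup>2 - w\<^sup>2) + (y\<^sup>2 - x\<^sup>2) + x\<^sup>2 * (z\<^sup>2 - y\<^sup>2)) / (x * y)"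
      using pos by (simp add: field_simps power2_eq_square)
    also have "y\<^sup>2 * (x\<^sup>2 - w\<^sup>2) + (y\<^sup>2 - x\<^sup>2) + x\<^sup>2 * (z\<^sup>2 - y\<^sup>2) = ?q 2 * (y\<^sup>2 - x\<^sup>2) * (x * y)"
      using rel by algebra
    finally show ?thesis
      unfolding \<phi> using pos by simp
  qed
  have sym: "?S i j = ?S j i" for i j
    by (simp add: star_cell_swap)
  from a obtain m l where ml: "i = Suc m" "j = Suc l"
    unfolding adj_def by (cases i; cases j) auto
  from a consider "l = Suc m" "Suc m < n" | "m = Suc l" "Suc l < n" | "l = m" "1 \<le> m" "m < n"
    unfolding adj_def ml by auto
  then show ?thesis
  proof cases
    case 1
    then show ?thesis using edge[of m] by (simp add: ml)
  next
    case 2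
    then show ?thesis using edge[of l] sym[of i j] by (simp add: ml mult_ac)
  next
    case 3
    then show ?thesis using loop[of m] by (simp add: ml)
  qed
qed

text \<open>
  The two sides of the type II equation for the real symmetric cells. In this case both sides are invariant
  under rotating and under reversing the closed walk $i_1, i_2, i_3, i_4$.
\<close>

definition type_II_lhs :: "nat \<Rightarrow> nat \<Rightarrow> nat \<Rightarrow> nat \<Rightarrow> nat \<Rightarrow> real" where
  "type_II_lhs n i\<^sub>1 i\<^sub>2 i\<^sub>3 i\<^sub>4 = (\<Sum>k\<in>{1..n}. inverse (A_star_vec n k) *
     star_cell n i\<^sub>1 i\<^sub>2 k * star_cell n i\<^sub>3 i\<^sub>2 k * star_cell n i\<^sub>3 i\<^sub>4 k * star_cell n i\<^sub>1 i\<^sub>4 k)"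

definition type_II_rhs :: "nat \<Rightarrow> nat \<Rightarrow> nat \<Rightarrow> nat \<Rightarrow> nat \<Rightarrow> real" where
  "type_II_rhs n i\<^sub>1 i\<^sub>2 i\<^sub>3 i\<^sub>4 =
     of_bool (i\<^sub>2 = i\<^sub>4) * (A_star_vec n i\<^sub>1 * A_star_vec n i\<^sub>2 * A_star_vec n i\<^sub>3)
     + of_bool (i\<^sub>1 = i\<^sub>3) * (A_star_vec n i\<^sub>1 * A_star_vec n i\<^sub>2 * A_star_vec n i\<^sub>4)"

lemma type_II_lhs_rotate: "type_II_lhs n a b c d = type_II_lhs n b c d a"
proof -
  have "star_cell n c b k = star_cell n b c k" "star_cell n a d k = star_cell n d a k" "star_cell n d c k = star_cell n c d k"
    "star_cell n b a k = star_cell n a b k" for k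
    by (rule star_cell_swap)+
  then show ?thesis
    unfolding type_II_lhs_def by (intro sum.cong refl) (simp only: mult_ac)
qed

lemma type_II_lhs_reflect: "type_II_lhs n a b c d = type_II_lhs n a d c b"
  unfolding type_II_lhs_def by (intro sum.cong refl) (simp only: mult_ac)

lemma type_II_rhs_rotate: "type_II_rhs n a b c d = type_II_rhs n b c d a"
  by (auto simp: type_II_rhs_def)

lemma type_II_rhs_reflect: "type_II_rhs n a b c d = type_II_rhs n a d c b"
  by (auto simp: type_II_rhs_def)

text \<open>
  Rotate the walk so that it starts at its smallest vertex $m$ and orient it so that the second
  vertex does not exceed the fourth. These two are then $m$ or $m+1$, which leaves seven walks, two of
  which are rotations of each other.
\<close>

lemma closed_walk_cases:
  assumes walk: "adj n a b" "adj n b c" "adj n c d" "adj n d a"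
    and rotate: "\<And>a b c d. P a b c d \<Longrightarrow> P b c d a"
    and reflect: "\<And>a b c d. P a b c d \<Longrightarrow> P a d c b"
    and const: "\<And>m. 2 \<le> m \<Longrightarrow> m \<le> n \<Longrightarrow> P m m m m"
    and one_up: "\<And>m. 2 \<le> m \<Longrightarrow> m < n \<Longrightarrow> P m m m (Suc m)"
    and one_down: "\<And>m. 1 \<le> m \<Longrightarrow> m < n \<Longrightarrow> P m (Suc m) (Suc m) (Suc m)"
    and adjacent: "\<And>m. 2 \<le> m \<Longrightarrow> m < n \<Longrightarrow> P m m (Suc m) (Suc m)"
    and alternating: "\<And>m. 1 \<le> m \<Longrightarrow> m < n \<Longrightarrow> P m (Suc m) m (Suc m)"
    and three: "\<And>m. 1 \<le> m \<Longrightarrow> Suc m < n \<Longrightarrow> P m (Suc m) (Suc (Suc m)) (Suc m)"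
  shows "P a b c d"
proof -
  have min_first: "P a b c d"
    if w: "adj n a b" "adj n b c" "adj n c d" "adj n d a" and le: "a \<le> b" "b \<le> d" "a \<le> c"
    for a b c d
  proof -
    have "b = a \<or> b = Suc a" "d = a \<or> d = Suc a" "c = a \<or> c = Suc a \<or> c = Suc (Suc a)"
      using w le by (auto simp: adj_def)
    then consider "b = a" "c = a" "d = a" | "b = a" "c = Suc a" "d = a"
      | "b = a" "c = a" "d = Suc a" | "b = a" "c = Suc a" "d = Suc a" | "b = Suc a" "c = a" "d = Suc a"
      | "b = Suc a" "c = Suc a" "d = Suc a" | "b = Suc a" "c = Suc (Suc a)" "d = Suc a"
      using w le by (auto simp: adj_def)
    moreover have "1 \<le> a" "a \<le> n" "b = a \<Longrightarrow> 2 \<le> a" "c \<noteq> a \<Longrightarrow> a < n" "d \<noteq> a \<Longrightarrow> a < n"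
      "c = Suc (Suc a) \<Longrightarrow> Suc a < n"
      using w le by (auto simp: adj_def)
    ultimately show ?thesis
      by cases (simp_all add: const one_up one_up[THEN rotate] one_down adjacent alternating three)
  qed
  have min_any: "P a b c d"
    if w: "adj n a b" "adj n b c" "adj n c d" "adj n d a" and le: "a \<le> b" "a \<le> c" "a \<le> d"
    for a b c d
  proof (cases "b \<le> d")
    case True
    then show ?thesis using min_first w le by blast
  next
    case False
    then have "P a d c b"
      using min_first[of a d c b] w le by (simp add: adj_sym)
    then show ?thesis by (rule reflect)
  qed
  consider "a \<le> b" "a \<le> c" "a \<le> d" | "b \<le> c" "b \<le> d" "b \<le> a" | "c \<le> d" "c \<le> a" "c \<le> b" | "d \<le> a" "d \<le> b" "d \<le> c"
    by linarith
  then show ?thesis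
  proof cases
    case 1
    then show ?thesis using min_any walk by blast
  next
    case 2
    then have "P b c d a" using min_any walk by blast
    then show ?thesis by (rule rotate[OF rotate[OF rotate]])
  next
    case 3
    then have "P c d a b" using min_any walk by blast
    then show ?thesis by (rule rotate[OF rotate])
  next
    case 4
    then have "P d a b c" using min_any walk by blast
    then show ?thesis by (rule rotate)
  qed
qed

lemma type_II_lhs_eval:
  assumes "adj n (Suc m) b"
  shows "type_II_lhs n (Suc m) b c d =
     star_cell n (Suc m) b m * (inverse (A_star_vec n m) * star_cell n c b m * star_cell n c d m * star_cell n (Suc m) d m)
   + star_cell n (Suc m) b (Suc m) * (inverse (A_star_vec n (Suc m)) * star_cell n c b (Suc m) * star_cell n c d (Suc m) * star_cell n (Suc m) d (Suc m))
   + star_cell n (Suc m) b (Suc (Suc m)) *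
       (inverse (A_star_vec n (Suc (Suc m))) * star_cell n c b (Suc (Suc m)) * star_cell n c d (Suc (Suc m)) * star_cell n (Suc m) d (Suc (Suc m)))"
proof -
  have "type_II_lhs n (Suc m) b c d = (\<Sum>k\<in>{1..n}. star_cell n (Suc m) b k *
      (inverse (A_star_vec n k) * star_cell n c b k * star_cell n c d k * star_cell n (Suc m) d k))"
    unfolding type_II_lhs_def by (intro sum.cong refl) (simp only: mult_ac)
  then show ?thesis
    by (simp only: sum_star_cell[OF assms]) simp
qed

text \<open>
  Each of the six shapes of walks has at most three common neighbours to sum over, and after inserting the squares of the
  cells the equation is an identity between consecutive quantum integers $w, x, y, z$, modulo
  $wy = x^2 - 1$ and $xz = y^2 - 1$. The walk $m, m, m+1, m+1$ is the only one in which the cells do not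
  occur as squares; it needs the signs of the loop cells.
\<close>

lemma type_II_lhs_star_cell:
  assumes n: "2 \<le> n" and walk: "adj n a b" "adj n b c" "adj n c d" "adj n d a"
  shows "type_II_lhs n a b c d = type_II_rhs n a b c d"
proof (rule closed_walk_cases[OF walk])
  let ?q = "qint (2 * n + 1)" and ?\<phi> = "A_star_vec n"
  show "type_II_lhs n b c d a = type_II_rhs n b c d a" if "type_II_lhs n a b c d = type_II_rhs n a b c d" for a b c d
    using that type_II_lhs_rotate type_II_rhs_rotate by metis
  show "type_II_lhs n a d c b = type_II_rhs n a d c b" if "type_II_lhs n a b c d = type_II_rhs n a b c d" for a b c d
    using that type_II_lhs_reflect type_II_rhs_reflect by metis
  have edge: "type_II_lhs n m (Suc m) (Suc m) (Suc m) = type_II_rhs n m (Suc m) (Suc m) (Suc m) \<and>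
      type_II_lhs n m (Suc m) m (Suc m) = type_II_rhs n m (Suc m) m (Suc m) \<and>
      (2 \<le> m \<longrightarrow> type_II_lhs n m m m (Suc m) = type_II_rhs n m m m (Suc m) \<and>
        type_II_lhs n m m (Suc m) (Suc m) = type_II_rhs n m m (Suc m) (Suc m))"
    if m: "1 \<le> m" "m < n" for m
  proof (intro conjI impI)
    obtain l where l: "m = Suc l"
      using m by (cases m) auto
    define w x y where "w = ?q l" and "x = ?q m" and "y = ?q (Suc m)"
    define p r where "p = ?\<phi> m" and "r = ?\<phi> (Suc m)"
    have nz: "x \<noteq> 0" "y \<noteq> 0" "p \<noteq> 0" "r \<noteq> 0"
      using qint_odd_pos[of m n] qint_odd_pos[of "Suc m" n] A_star_vec_pos[of m n] A_star_vec_pos[of "Suc m" n] m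
      by (auto simp: x_def y_def p_def r_def)
    have rel: "w * y = x\<^sup>2 - 1"
      using qint_mult_Suc_Suc[of "2 * n + 1" l] n by (simp add: x_def y_def w_def l)
    have pr: "p = x\<^sup>2 - w\<^sup>2" "r = y\<^sup>2 - x\<^sup>2"
      using n A_star_vec_Suc[of n l] A_star_vec_Suc[of n m]
      by (simp_all add: x_def y_def w_def p_def r_def l)
    have A2: "(upper_cell n (Suc m))\<^sup>2 = y * p * r / x" and C2': "(loop_cell n (Suc m))\<^sup>2 = r\<^sup>2 / (x * y)"
      using upper_cell_sq[OF m] loop_cell_sq[OF m] by (simp_all add: x_def y_def p_def r_def)
    have B2: "(lower_cell n m)\<^sup>2 = w * p * r / x"
      using lower_cell_sq[of l n] m by (simp add: x_def w_def p_def r_def l)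
    show "type_II_lhs n m (Suc m) (Suc m) (Suc m) = type_II_rhs n m (Suc m) (Suc m) (Suc m)"
    proof -
      have "type_II_lhs n m (Suc m) (Suc m) (Suc m)
          = (upper_cell n (Suc m))\<^sup>2 * ((lower_cell n m)\<^sup>2 / p + (loop_cell n (Suc m))\<^sup>2 / r)"
        using m unfolding l
        by (subst type_II_lhs_eval) (auto simp: adj_def star_cell_far' p_def r_def l power2_eq_square divide_inverse distrib_left mult_ac)
      also have "\<dots> = p * r\<^sup>2 * (w * y + 1) / x\<^sup>2"
        unfolding A2 B2 C2' using nz by (simp add: divide_simps) (simp add: power2_eq_square algebra_simps)
      also have "\<dots> = type_II_rhs n m (Suc m) (Suc m) (Suc m)"
        unfolding rel using nz by (simp add: type_II_rhs_def p_def r_def power2_eq_square)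
      finally show ?thesis .
    qed
    show "type_II_lhs n m (Suc m) m (Suc m) = type_II_rhs n m (Suc m) m (Suc m)"
    proof -
      have "type_II_lhs n m (Suc m) m (Suc m) = ((lower_cell n m)\<^sup>2)\<^sup>2 / p + ((upper_cell n (Suc m))\<^sup>2)\<^sup>2 / r"
        using m unfolding l
        by (subst type_II_lhs_eval) (auto simp: adj_def star_cell_far' p_def r_def l power2_eq_square divide_inverse mult_ac)
      also have "\<dots> = p * r * (w\<^sup>2 * r + y\<^sup>2 * p) / x\<^sup>2"
        unfolding A2 B2 using nz by (simp add: divide_simps) (simp add: power2_eq_square algebra_simps)
      also have "w\<^sup>2 * r + y\<^sup>2 * p = x\<^sup>2 * (p + r)"
        unfolding pr by (simp add: algebra_simps)
      also have "p * r * (x\<^sup>2 * (p + r)) / x\<^sup>2 = p * r * (p + r)"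
        using nz by simp
      also have "\<dots> = type_II_rhs n m (Suc m) m (Suc m)"
        by (simp add: type_II_rhs_def p_def r_def algebra_simps)
      finally show ?thesis .
    qed
    assume m2: "2 \<le> m"
    have "w \<noteq> 0"
      using qint_odd_pos[of l n] m2 m by (auto simp: w_def l)
    have C2: "(loop_cell n m)\<^sup>2 = p\<^sup>2 / (w * x)"
      using loop_cell_sq[of l n] m m2 by (simp add: x_def w_def p_def l)
    show "type_II_lhs n m m m (Suc m) = type_II_rhs n m m m (Suc m)"
    proof -
      have "type_II_lhs n m m m (Suc m)
          = (lower_cell n m)\<^sup>2 * ((loop_cell n m)\<^sup>2 / p + (upper_cell n (Suc m))\<^sup>2 / r)"
        using m m2 unfolding l
        by (subst type_II_lhs_eval) (auto simp: adj_def star_cell_far' p_def r_def l power2_eq_square divide_inverse distrib_left mult_ac)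
      also have "\<dots> = p\<^sup>2 * r * (w * y + 1) / x\<^sup>2"
        unfolding A2 B2 C2 using nz \<open>w \<noteq> 0\<close> by (simp add: divide_simps) (simp add: power2_eq_square algebra_simps)
      also have "\<dots> = type_II_rhs n m m m (Suc m)"
        unfolding rel using nz by (simp add: type_II_rhs_def p_def r_def power2_eq_square)
      finally show ?thesis .
    qed
    show "type_II_lhs n m m (Suc m) (Suc m) = type_II_rhs n m m (Suc m) (Suc m)"
    proof -
      have "type_II_lhs n m m (Suc m) (Suc m) = upper_cell n (Suc m) * lower_cell n m *
          (loop_cell n m * lower_cell n m / p + loop_cell n (Suc m) * upper_cell n (Suc m) / r)"
        using m m2 unfolding l
        by (subst type_II_lhs_eval) (auto simp: adj_def star_cell_far' p_def r_def l divide_inverse distrib_left mult_ac)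
      also have "loop_cell n m * lower_cell n m / p + loop_cell n (Suc m) * upper_cell n (Suc m) / r = 0"
        using loop_cell_lower_cell[of l n] loop_cell_upper_cell[OF m] m m2 by (simp add: p_def r_def l)
      finally show ?thesis
        by (simp add: type_II_rhs_def)
    qed
  qed
  show "type_II_lhs n m (Suc m) (Suc m) (Suc m) = type_II_rhs n m (Suc m) (Suc m) (Suc m)"
    and "type_II_lhs n m (Suc m) m (Suc m) = type_II_rhs n m (Suc m) m (Suc m)" if "1 \<le> m" "m < n" for m
    using edge[OF that] by blast+
  show "type_II_lhs n m m m (Suc m) = type_II_rhs n m m m (Suc m)"
    and "type_II_lhs n m m (Suc m) (Suc m) = type_II_rhs n m m (Suc m) (Suc m)" if "2 \<le> m" "m < n" for m
    using edge[of m] that by simp_all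
  show "type_II_lhs n m (Suc m) (Suc (Suc m)) (Suc m) = type_II_rhs n m (Suc m) (Suc (Suc m)) (Suc m)"
    if m: "1 \<le> m" "Suc m < n" for m
  proof -
    obtain l where l: "m = Suc l"
      using m by (cases m) auto
    define x y where "x = ?q m" and "y = ?q (Suc m)"
    define p r s where "p = ?\<phi> m" and "r = ?\<phi> (Suc m)" and "s = ?\<phi> (Suc (Suc m))"
    have nz: "x \<noteq> 0" "y \<noteq> 0" "r \<noteq> 0"
      using qint_odd_pos[of m n] qint_odd_pos[of "Suc m" n] A_star_vec_pos[of "Suc m" n] m
      by (auto simp: x_def y_def r_def)
    have A2: "(upper_cell n (Suc m))\<^sup>2 = y * p * r / x" and B2: "(lower_cell n (Suc m))\<^sup>2 = x * r * s / y"
      using upper_cell_sq[of m n] lower_cell_sq[of m n] m by (simp_all add: x_def y_def p_def r_def s_def)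
    have "type_II_lhs n m (Suc m) (Suc (Suc m)) (Suc m) = (upper_cell n (Suc m))\<^sup>2 * (lower_cell n (Suc m))\<^sup>2 / r"
      using m unfolding l
      by (subst type_II_lhs_eval) (auto simp: adj_def star_cell_far star_cell_far' r_def l power2_eq_square divide_inverse mult_ac)
    also have "\<dots> = type_II_rhs n m (Suc m) (Suc (Suc m)) (Suc m)"
      unfolding A2 B2 using nz by (simp add: type_II_rhs_def p_def r_def s_def field_simps)
    finally show ?thesis .
  qed
  show "type_II_lhs n m m m m = type_II_rhs n m m m m" if m: "2 \<le> m" "m \<le> n" for m
  proof -
    obtain k where k: "m = Suc (Suc k)"
      using m by (metis Suc_le_D numeral_2_eq_2 Suc_le_D Suc_le_mono)
    define w x y z where "w = ?q k" and "x = ?q (Suc k)" and "y = ?q m" and "z = ?q (Suc m)"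
    define p r s where "p = ?\<phi> (Suc k)" and "r = ?\<phi> m" and "s = ?\<phi> (Suc m)"
    have nz: "x \<noteq> 0" "y \<noteq> 0" "p \<noteq> 0" "r \<noteq> 0"
      using qint_odd_pos[of "Suc k" n] qint_odd_pos[of m n] A_star_vec_pos[of "Suc k" n] A_star_vec_pos[of m n] m
      by (auto simp: x_def y_def p_def r_def k)
    have rel: "w * y = x\<^sup>2 - 1" "x * z = y\<^sup>2 - 1"
      using qint_mult_Suc_Suc[of "2 * n + 1" k] qint_mult_Suc_Suc[of "2 * n + 1" "Suc k"] n
      by (simp_all add: x_def y_def w_def z_def k)
    have prs: "p = x\<^sup>2 - w\<^sup>2" "r = y\<^sup>2 - x\<^sup>2" "s = z\<^sup>2 - y\<^sup>2"
      using n A_star_vec_Suc[of n k] A_star_vec_Suc[of n "Suc k"] A_star_vec_Suc[of n m]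
      by (simp_all add: x_def y_def w_def z_def p_def r_def s_def k)
    have A2: "(upper_cell n m)\<^sup>2 = y * p * r / x" and C2: "(loop_cell n m)\<^sup>2 = r\<^sup>2 / (x * y)"
      and B2: "(lower_cell n m)\<^sup>2 = x * r * s / y"
      using upper_cell_sq[of "Suc k" n] loop_cell_sq[of "Suc k" n] lower_cell_sq[of "Suc k" n] m
      by (simp_all add: x_def y_def p_def r_def s_def k)
    have "type_II_lhs n m m m m = ((upper_cell n m)\<^sup>2)\<^sup>2 / p + ((loop_cell n m)\<^sup>2)\<^sup>2 / r + ((lower_cell n m)\<^sup>2)\<^sup>2 / s"
      using m unfolding k
      by (subst type_II_lhs_eval) (auto simp: adj_def p_def r_def s_def k power2_eq_square divide_inverse mult_ac)
    \<comment> \<open>For \<open>m = n\<close> both sides are zero, as then \<open>s = 0\<close>.\<close>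
    also have "((lower_cell n m)\<^sup>2)\<^sup>2 / s = x\<^sup>2 * r\<^sup>2 * s / y\<^sup>2"
      unfolding B2 by (cases "s = 0") (auto simp: power2_eq_square)
    also have "((upper_cell n m)\<^sup>2)\<^sup>2 / p + ((loop_cell n m)\<^sup>2)\<^sup>2 / r + x\<^sup>2 * r\<^sup>2 * s / y\<^sup>2
        = r\<^sup>2 * (y ^ 4 * p + r + x ^ 4 * s) / (x\<^sup>2 * y\<^sup>2)"
      unfolding A2 C2 using nz by (simp add: divide_simps) (simp add: power2_eq_square power4_eq_xxxx algebra_simps)
    also have "y ^ 4 * p + r + x ^ 4 * s = 2 * r * (x\<^sup>2 * y\<^sup>2)"
      unfolding prs using rel by algebra
    also have "r\<^sup>2 * (2 * r * (x\<^sup>2 * y\<^sup>2)) / (x\<^sup>2 * y\<^sup>2) = type_II_rhs n m m m m"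
      using nz by (simp add: type_II_rhs_def r_def power2_eq_square)
    finally show ?thesis .
  qed
qed

lemma cell_system_star_cells:
  assumes n: "2 \<le> n"
  shows "cell_system (A_star n) (2 * n + 1) (A_star_vec n) (star_cells n)"
  unfolding cell_system_A_star_iff[OF perron_frobenius_A_star[OF n]] vertex_cell_system_def
proof (intro conjI allI impI)
  show "tri_val n (star_cells n) a b c = tri_val n (star_cells n) b c a" for a b c
    using star_cell_rotate[of n a b c] by (auto simp: tri_val_def)
next
  fix i j assume a: "adj n i j"
  show "(\<Sum>k\<in>{1..n}. (cmod (tri_val n (star_cells n) i j k))\<^sup>2) = qint (2 * n + 1) 2 * A_star_vec n i * A_star_vec n j"
    using star_cell_type_I[OF n a] tri_val_star_cells[OF a] by simp
next
  fix a b c d assume w: "adj n a b" "adj n c b" "adj n c d" "adj n a d"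
  have "(\<Sum>k\<in>{1..n}. of_real (inverse (A_star_vec n k)) * tri_val n (star_cells n) a b k * cnj (tri_val n (star_cells n) c b k) *
      tri_val n (star_cells n) c d k * cnj (tri_val n (star_cells n) a d k)) = of_real (type_II_lhs n a b c d)"
    unfolding type_II_lhs_def of_real_sum by (intro sum.cong refl) (simp add: tri_val_star_cells w)
  also have "type_II_lhs n a b c d = type_II_rhs n a b c d"
    using type_II_lhs_star_cell[OF n] w adj_sym by metis
  finally show "(\<Sum>k\<in>{1..n}. of_real (inverse (A_star_vec n k)) * tri_val n (star_cells n) a b k * cnj (tri_val n (star_cells n) c b k) *
      tri_val n (star_cells n) c d k * cnj (tri_val n (star_cells n) a d k))
     = of_bool (b = d) * of_real (A_star_vec n a * A_star_vec n b * A_star_vec n c)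
      + of_bool (a = c) * of_real (A_star_vec n a * A_star_vec n b * A_star_vec n d)"
    by (simp add: type_II_rhs_def)
qed

section \<open>Rigidity of the moduli\<close>

lemma tri_val_rotate:
  "cell_system (A_star n) h \<phi> W \<Longrightarrow> tri_val n W a b c = tri_val n W b c a"
  using cell_system_A_star_iff[OF cell_system.axioms(1)] unfolding vertex_cell_system_def by blast

lemma tri_val_type_I:
  "cell_system (A_star n) h \<phi> W \<Longrightarrow> adj n i j \<Longrightarrow>
    (\<Sum>k\<in>{1..n}. (cmod (tri_val n W i j k))\<^sup>2) = qint h 2 * \<phi> i * \<phi> j"
  using cell_system_A_star_iff[OF cell_system.axioms(1)] unfolding vertex_cell_system_def by blast

lemma tri_val_type_II:
  assumes "cell_system (A_star n) h \<phi> W"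
    and "adj n i\<^sub>1 i\<^sub>2" "adj n i\<^sub>3 i\<^sub>2" "adj n i\<^sub>3 i\<^sub>4" "adj n i\<^sub>1 i\<^sub>4"
  shows "(\<Sum>k\<in>{1..n}. of_real (inverse (\<phi> k)) * tri_val n W i\<^sub>1 i\<^sub>2 k * cnj (tri_val n W i\<^sub>3 i\<^sub>2 k) *
      tri_val n W i\<^sub>3 i\<^sub>4 k * cnj (tri_val n W i\<^sub>1 i\<^sub>4 k))
    = of_bool (i\<^sub>2 = i\<^sub>4) * of_real (\<phi> i\<^sub>1 * \<phi> i\<^sub>2 * \<phi> i\<^sub>3)
    + of_bool (i\<^sub>1 = i\<^sub>3) * of_real (\<phi> i\<^sub>1 * \<phi> i\<^sub>2 * \<phi> i\<^sub>4)"
proof -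
  have "vertex_cell_system n h \<phi> (tri_val n W)"
    using assms(1) cell_system_A_star_iff[OF cell_system.axioms(1)] by blast
  then show ?thesis
    unfolding vertex_cell_system_def using assms(2-5) by blast
qed

lemma tri_val_eq_0: "\<not> (adj n a b \<and> adj n b c \<and> adj n c a) \<Longrightarrow> tri_val n W a b c = 0"
  unfolding tri_val_def by (simp only: if_False)

lemma tri_val_neighbour_sum:
  assumes "1 \<le> i" and "\<And>k. tri_val n W i j k = 0 \<Longrightarrow> f k = 0"
  shows "(\<Sum>k\<in>{1..n}. f k) = f (i - 1) + f i + f (i + 1)"
  by (rule sum_neighbours[OF assms(1)]; rule assms(2), rule tri_val_eq_0) (auto simp: adj_def)

text \<open>
  A cell system is determined by four families of its equations: type I on the edge $m, m+1$ and on the loop at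
  $m+1$, and type II on the walks $m, m+1, m+2, m+1$ and $m+1, m+1, m, m$.
\<close>

lemma edge_modulus:
  assumes W: "cell_system (A_star n) h \<phi> W" and m: "1 \<le> m" "m < n"
  shows "(cmod (tri_val n W m m (Suc m)))\<^sup>2 + (cmod (tri_val n W m (Suc m) (Suc m)))\<^sup>2
    = qint h 2 * \<phi> m * \<phi> (Suc m)"
proof -
  have a: "adj n m (Suc m)"
    using m by (simp add: adj_def)
  have "tri_val n W m (Suc m) (m - 1) = 0"
    by (rule tri_val_eq_0) (use m in \<open>auto simp: adj_def\<close>)
  moreover have "(\<Sum>k\<in>{1..n}. (cmod (tri_val n W m (Suc m) k))\<^sup>2)
      = (cmod (tri_val n W m (Suc m) (m - 1)))\<^sup>2 + (cmod (tri_val n W m (Suc m) m))\<^sup>2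
        + (cmod (tri_val n W m (Suc m) (m + 1)))\<^sup>2"
    by (rule tri_val_neighbour_sum[OF m(1)]) simp
  ultimately show ?thesis
    using tri_val_type_I[OF W a] tri_val_rotate[OF W, of m m "Suc m"] by simp
qed

lemma loop_modulus:
  assumes W: "cell_system (A_star n) h \<phi> W" and m: "1 \<le> m" "m < n"
  shows "(cmod (tri_val n W m (Suc m) (Suc m)))\<^sup>2 + (cmod (tri_val n W (Suc m) (Suc m) (Suc m)))\<^sup>2
      + (cmod (tri_val n W (Suc m) (Suc m) (Suc (Suc m))))\<^sup>2
    = qint h 2 * \<phi> (Suc m) * \<phi> (Suc m)"
proof -
  have a: "adj n (Suc m) (Suc m)"
    using m by (simp add: adj_def)
  have "(\<Sum>k\<in>{1..n}. (cmod (tri_val n W (Suc m) (Suc m) k))\<^sup>2)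
      = (cmod (tri_val n W (Suc m) (Suc m) (Suc m - 1)))\<^sup>2 + (cmod (tri_val n W (Suc m) (Suc m) (Suc m)))\<^sup>2
        + (cmod (tri_val n W (Suc m) (Suc m) (Suc m + 1)))\<^sup>2"
    by (rule tri_val_neighbour_sum) simp_all
  then show ?thesis
    using tri_val_type_I[OF W a] tri_val_rotate[OF W, of m "Suc m" "Suc m"]
      tri_val_rotate[OF W, of "Suc m" "Suc m" m] by simp
qed

text \<open>
  The only vertex adjacent to both $m$ and $m+2$ is $m+1$, so the type II sum has a single term, the
  product of two squared moduli.
\<close>

lemma consecutive_modulus:
  assumes W: "cell_system (A_star n) h \<phi> W" and m: "1 \<le> m" "Suc m < n"
  shows "(cmod (tri_val n W m (Suc m) (Suc m)))\<^sup>2 * (cmod (tri_val n W (Suc m) (Suc m) (Suc (Suc m))))\<^sup>2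
    = \<phi> m * \<phi> (Suc m) ^ 2 * \<phi> (Suc (Suc m))"
proof -
  have pos: "0 < \<phi> (Suc m)"
    using perron_frobenius_digraph.eigenvector_pos[OF cell_system.axioms(1)[OF W]] m by simp
  let ?A = "tri_val n W m (Suc m) (Suc m)" and ?B = "tri_val n W (Suc m) (Suc m) (Suc (Suc m))"
  let ?f = "\<lambda>k. of_real (inverse (\<phi> k)) * tri_val n W m (Suc m) k * cnj (tri_val n W (Suc (Suc m)) (Suc m) k) *
      tri_val n W (Suc (Suc m)) (Suc m) k * cnj (tri_val n W m (Suc m) k)"
  have a: "adj n m (Suc m)" "adj n (Suc (Suc m)) (Suc m)"
    using m by (simp_all add: adj_def)
  have "(\<Sum>k\<in>{1..n}. ?f k) = ?f (m - 1) + ?f m + ?f (m + 1)"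
    by (rule tri_val_neighbour_sum[of m n W "Suc m"]) (use m in simp_all)
  moreover have "tri_val n W m (Suc m) (m - 1) = 0" "tri_val n W (Suc (Suc m)) (Suc m) m = 0"
    by (rule tri_val_eq_0, use m in \<open>auto simp: adj_def\<close>)+
  moreover have "tri_val n W (Suc (Suc m)) (Suc m) (Suc m) = ?B"
    by (rule tri_val_rotate[OF W])
  ultimately have "of_real (inverse (\<phi> (Suc m))) * ?A * cnj ?B * ?B * cnj ?A
      = of_real (\<phi> m * \<phi> (Suc m) * \<phi> (Suc (Suc m)))"
    using tri_val_type_II[OF W a(1) a(2) a(2) a(1)] by simp
  moreover have "of_real (inverse (\<phi> (Suc m))) * ?A * cnj ?B * ?B * cnj ?A
      = of_real (inverse (\<phi> (Suc m)) * ((cmod ?A)\<^sup>2 * (cmod ?B)\<^sup>2))"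
    by (simp only: of_real_mult of_real_inverse complex_norm_square mult_ac)
  ultimately have "inverse (\<phi> (Suc m)) * ((cmod ?A)\<^sup>2 * (cmod ?B)\<^sup>2) = \<phi> m * \<phi> (Suc m) * \<phi> (Suc (Suc m))"
    using of_real_eq_iff by metis
  then show ?thesis
    using pos by (simp add: field_simps power2_eq_square)
qed

text \<open>
  Up to rotation and reversal of the walk this is the only equation in which the phases of the cells matter: it relates the loop cells at two neighbouring vertices.
\<close>

lemma adjacent_loops:
  assumes W: "cell_system (A_star n) h \<phi> W" and m: "2 \<le> m" "m < n"
  shows "of_real (inverse (\<phi> (Suc m))) * tri_val n W (Suc m) (Suc m) (Suc m) *
        cnj (tri_val n W m (Suc m) (Suc m)) ^ 2 * tri_val n W m m (Suc m)
    + of_real (inverse (\<phi> m)) * tri_val n W m m m * cnj (tri_val n W m m (Suc m)) ^ 2 *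
        tri_val n W m (Suc m) (Suc m) = 0"
proof -
  let ?f = "\<lambda>k. of_real (inverse (\<phi> k)) * tri_val n W (Suc m) (Suc m) k * cnj (tri_val n W m (Suc m) k) *
      tri_val n W m m k * cnj (tri_val n W (Suc m) m k)"
  have a: "adj n (Suc m) (Suc m)" "adj n m (Suc m)" "adj n m m" "adj n (Suc m) m"
    using m by (simp_all add: adj_def)
  have "(\<Sum>k\<in>{1..n}. ?f k) = ?f (m - 1) + ?f m + ?f (m + 1)"
    by (rule tri_val_neighbour_sum[of m n W "Suc m"]) (use m in simp_all)
  moreover have "tri_val n W m (Suc m) (m - 1) = 0"
    by (rule tri_val_eq_0) (use m in \<open>auto simp: adj_def\<close>)
  moreover have "tri_val n W (Suc m) (Suc m) m = tri_val n W m (Suc m) (Suc m)"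
    "tri_val n W (Suc m) m (Suc m) = tri_val n W m (Suc m) (Suc m)"
    "tri_val n W m (Suc m) m = tri_val n W m m (Suc m)"
    "tri_val n W (Suc m) m m = tri_val n W m m (Suc m)"
    using tri_val_rotate[OF W] by metis+
  ultimately show ?thesis
    using tri_val_type_II[OF W a] by (simp add: power2_eq_square mult_ac add_ac)
qed

lemma cmod_eqI: "(cmod a)\<^sup>2 = (cmod b)\<^sup>2 \<Longrightarrow> cmod a = cmod b"
  by (rule power2_eq_imp_eq) auto

text \<open>
  Along the path the moduli are forced one after the other: the triangle $1, 1, 2$ does not exist, so type I on the edge
  between 1 and 2 gives the modulus on $1, 2, 2$; the modulus on $m, m+1, m+1$, being nonzero, determines the one on
  $m+1, m+1, m+2$ by their known product, and then type I on the edge $m+1, m+2$ determines the one on $m+1, m+2, m+2$.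
\<close>

lemma moduli_unique:
  assumes W: "cell_system (A_star n) h \<phi> W" and W': "cell_system (A_star n) h \<phi> W'"
    and m: "1 \<le> m" "m < n"
    and nz: "\<And>m. 1 \<le> m \<Longrightarrow> m < n \<Longrightarrow> tri_val n W m (Suc m) (Suc m) \<noteq> 0"
  shows "cmod (tri_val n W' m m (Suc m)) = cmod (tri_val n W m m (Suc m)) \<and>
    cmod (tri_val n W' m (Suc m) (Suc m)) = cmod (tri_val n W m (Suc m) (Suc m))"
  using m
proof (induction m rule: nat_induct_at_least)
  case base
  have "tri_val n V 1 1 (Suc 1) = 0" for V
    by (rule tri_val_eq_0) (simp add: adj_def)
  moreover have "(cmod (tri_val n W' 1 (Suc 1) (Suc 1)))\<^sup>2 = (cmod (tri_val n W 1 (Suc 1) (Suc 1)))\<^sup>2"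
    using edge_modulus[OF W le_refl base] edge_modulus[OF W' le_refl base] calculation[of W] calculation[of W']
    by (metis add_0 norm_zero zero_power2)
  ultimately show ?case
    using cmod_eqI by metis
next
  case (Suc m)
  let ?a = "\<lambda>V. cmod (tri_val n V m (Suc m) (Suc m))"
  let ?b = "\<lambda>V. cmod (tri_val n V (Suc m) (Suc m) (Suc (Suc m)))"
  have a: "?a W' = ?a W" "?a W \<noteq> 0"
    using Suc nz by auto
  have "(?a W)\<^sup>2 * (?b W')\<^sup>2 = (?a W)\<^sup>2 * (?b W)\<^sup>2"
    using consecutive_modulus[OF W, of m] consecutive_modulus[OF W', of m] Suc a(1) by simp
  then have b: "(?b W')\<^sup>2 = (?b W)\<^sup>2"
    using a(2) by simp
  have "1 \<le> Suc m"
    by simp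
  then have "(cmod (tri_val n W' (Suc m) (Suc (Suc m)) (Suc (Suc m))))\<^sup>2
      = (cmod (tri_val n W (Suc m) (Suc (Suc m)) (Suc (Suc m))))\<^sup>2"
    using edge_modulus[OF W _ Suc.prems] edge_modulus[OF W' _ Suc.prems] b by linarith
  with b show ?case
    using cmod_eqI by blast
qed

lemma loop_moduli_unique:
  assumes W: "cell_system (A_star n) h \<phi> W" and W': "cell_system (A_star n) h \<phi> W'"
    and m: "1 \<le> m" "m < n"
    and nz: "\<And>m. 1 \<le> m \<Longrightarrow> m < n \<Longrightarrow> tri_val n W m (Suc m) (Suc m) \<noteq> 0"
  shows "cmod (tri_val n W' (Suc m) (Suc m) (Suc m)) = cmod (tri_val n W (Suc m) (Suc m) (Suc m))"
proof -
  have up: "cmod (tri_val n W' (Suc m) (Suc m) (Suc (Suc m))) = cmod (tri_val n W (Suc m) (Suc m) (Suc (Suc m)))"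
  proof (cases "Suc m < n")
    case True
    then show ?thesis using moduli_unique[OF W W', of "Suc m"] nz by simp
  next
    case False
    have "tri_val n V (Suc m) (Suc m) (Suc (Suc m)) = 0" for V
      by (rule tri_val_eq_0) (use False in \<open>simp add: adj_def\<close>)
    then show ?thesis by simp
  qed
  have down: "cmod (tri_val n W' m (Suc m) (Suc m)) = cmod (tri_val n W m (Suc m) (Suc m))"
    using moduli_unique[OF W W' m nz] by blast
  have "(cmod (tri_val n W' (Suc m) (Suc m) (Suc m)))\<^sup>2 = (cmod (tri_val n W (Suc m) (Suc m) (Suc m)))\<^sup>2"
    using loop_modulus[OF W m] loop_modulus[OF W' m] unfolding down up by linarith
  then show ?thesis
    by (rule cmod_eqI)
qed

section \<open>Absorbing the phases\<close>

lemma unimodular_quotient: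
  fixes v v' :: complex
  assumes "cmod v' = cmod v" "v \<noteq> 0"
  shows "cmod (v' / v) = 1 \<and> v' = v' / v * v"
  using assms by (simp add: norm_divide)

lemma unimodular_cube_root:
  assumes "cmod c = 1"
  obtains z where "cmod z = 1" "z ^ 3 = c"
proof
  show "cmod (cis (Arg c / 3)) = 1"
    by simp
  have "cis (Arg c / 3) ^ 3 = cis (Arg c)"
    by (simp only: Complex.DeMoivre) simp
  also have "\<dots> = c"
    using assms rcis_cmod_Arg[of c] by (simp add: rcis_def)
  finally show "cis (Arg c / 3) ^ 3 = c" .
qed

text \<open>
  Here \<open>\<alpha>\<close>, \<open>\<beta>\<close>, \<open>\<gamma>\<close>, \<open>\<gamma>1\<close> are the phases by which the cells of two cell systems differ; \<open>eq\<close>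
  and \<open>eq'\<close> are the equation of \<open>adjacent_loops\<close> for both. Each equation says that its two summands are
  opposite, so the phases gained by the two summands must agree.
\<close>

lemma phase_recursion:
  fixes C C1 A B \<alpha> \<beta> \<gamma> \<gamma>1 s t :: complex
  assumes eq: "s * C1 * cnj A ^ 2 * B + t * C * cnj B ^ 2 * A = 0"
    and eq': "s * (\<gamma>1 * C1) * cnj (\<alpha> * A) ^ 2 * (\<beta> * B) + t * (\<gamma> * C) * cnj (\<beta> * B) ^ 2 * (\<alpha> * A) = 0"
    and nz: "s \<noteq> 0" "C1 \<noteq> 0" "A \<noteq> 0" "B \<noteq> 0"
    and unit: "\<alpha> * cnj \<alpha> = 1" "\<beta> * cnj \<beta> = 1"
  shows "\<gamma>1 = (\<alpha> * cnj \<beta>) ^ 3 * \<gamma>"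
proof -
  define K where "K = s * C1 * cnj A ^ 2 * B"
  have "K \<noteq> 0"
    using nz by (simp add: K_def)
  have tK: "t * C * cnj B ^ 2 * A = - K"
    using eq by (simp add: K_def eq_neg_iff_add_eq_0 add.commute)
  have "K * (\<gamma>1 * cnj \<alpha> ^ 2 * \<beta>) + (t * C * cnj B ^ 2 * A) * (\<gamma> * cnj \<beta> ^ 2 * \<alpha>) = 0"
    using eq' unfolding K_def by (simp add: power_mult_distrib mult_ac)
  then have "\<gamma>1 * cnj \<alpha> ^ 2 * \<beta> = \<gamma> * cnj \<beta> ^ 2 * \<alpha>"
    unfolding tK using \<open>K \<noteq> 0\<close> by simp
  then show ?thesis
    using unit by algebra
qed

lemma triangle_vertex_cases:
  assumes "adj n a b" "adj n b c" "adj n c a"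
    and rotate: "\<And>a b c. P a b c \<Longrightarrow> P b c a"
    and "\<And>m. 2 \<le> m \<Longrightarrow> m \<le> n \<Longrightarrow> P m m m"
    and "\<And>m. 2 \<le> m \<Longrightarrow> m < n \<Longrightarrow> P m m (Suc m)"
    and "\<And>m. 1 \<le> m \<Longrightarrow> m < n \<Longrightarrow> P m (Suc m) (Suc m)"
  shows "P a b c"
proof -
  have eq: "P a a c" if ac: "adj n a a" "adj n a c" for a c
  proof -
    consider "c = a" | "c = Suc a" | "a = Suc c"
      using ac(2) unfolding adj_def by blast
    then show ?thesis
    proof cases
      case 3
      then have "P c (Suc c) (Suc c)"
        using ac assms(7) by (simp add: adj_def)
      from rotate[OF this] 3 show ?thesis by simp
    qed (use ac assms(5,6) in \<open>auto simp: adj_def\<close>)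
  qed
  consider "a = b" | "b = c" | "c = a"
    using assms(1-3) unfolding adj_def by linarith
  then show ?thesis
  proof cases
    case 1
    then show ?thesis using eq[of a c] assms(1,2) by simp
  next
    case 2
    then have "P b b a"
      using eq[of b a] assms(1,2) adj_sym by simp
    from rotate[OF rotate[OF this]] 2 show ?thesis by simp
  next
    case 3
    then have "P a a b"
      using eq[of a b] assms(1,3) by simp
    from rotate[OF this] 3 show ?thesis by simp
  qed
qed

text \<open>
  On a graph without multiple edges an equivalence multiplies each edge by a phase. With $z_m$ on the loop at \<open>m\<close>, $p_m$
  on $m \to m+1$ and 1 on $m+1 \to m$, the phases $\alpha_m, \beta_m, \gamma_m$ by which the two systems
  differ have to satisfy $p_m z_{m+1} = \alpha_m$, $p_m z_m = \beta_m$ and $z_m^3 = \gamma_m$. Eliminating $p_m$ gives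
  $z_{m+1} = \alpha_m \bar\beta_m z_m$, so everything is determined by a cube root $z_2$ of $\gamma_2$; the
  remaining conditions $z_m^3 = \gamma_m$ hold for all \<open>m\<close> by \<open>phase_recursion\<close>.
\<close>

lemma cell_equiv_A_star:
  assumes W: "cell_system (A_star n) h \<phi> W" and W': "cell_system (A_star n) h \<phi> W'"
    and nzA: "\<And>m. 1 \<le> m \<Longrightarrow> m < n \<Longrightarrow> tri_val n W m (Suc m) (Suc m) \<noteq> 0"
    and nzB: "\<And>m. 2 \<le> m \<Longrightarrow> m < n \<Longrightarrow> tri_val n W m m (Suc m) \<noteq> 0"
    and nzC: "\<And>m. 2 \<le> m \<Longrightarrow> m \<le> n \<Longrightarrow> tri_val n W m m m \<noteq> 0"
  shows "cell_equiv (A_star n) W' W"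
proof (cases "2 \<le> n")
  case n: True
  define \<alpha> \<beta> \<gamma> where
    "\<alpha> m = tri_val n W' m (Suc m) (Suc m) / tri_val n W m (Suc m) (Suc m)" and
    "\<beta> m = tri_val n W' m m (Suc m) / tri_val n W m m (Suc m)" and
    "\<gamma> m = tri_val n W' m m m / tri_val n W m m m" for m
  have \<alpha>: "cmod (\<alpha> m) = 1 \<and> tri_val n W' m (Suc m) (Suc m) = \<alpha> m * tri_val n W m (Suc m) (Suc m)"
    if "1 \<le> m" "m < n" for m
    unfolding \<alpha>_def by (rule unimodular_quotient) (use that moduli_unique[OF W W' that nzA] nzA in auto)
  have \<beta>: "cmod (\<beta> m) = 1 \<and> tri_val n W' m m (Suc m) = \<beta> m * tri_val n W m m (Suc m)"
    if "2 \<le> m" "m < n" for m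
    unfolding \<beta>_def by (rule unimodular_quotient) (use that moduli_unique[OF W W' _ _ nzA] nzB in auto)
  have \<gamma>: "cmod (\<gamma> m) = 1 \<and> tri_val n W' m m m = \<gamma> m * tri_val n W m m m"
    if "2 \<le> m" "m \<le> n" for m
    unfolding \<gamma>_def
    by (rule unimodular_quotient) (use that loop_moduli_unique[OF W W' _ _ nzA, of "m - 1"] nzC in auto)
  have unit: "c * cnj c = 1" if "cmod c = 1" for c
    using that complex_norm_square[of c] by simp
  obtain \<zeta> where \<zeta>: "cmod \<zeta> = 1" "\<zeta> ^ 3 = \<gamma> 2"
    using unimodular_cube_root \<gamma>[of 2] n by blast
  define z where "z m = \<zeta> * (\<Prod>k\<in>{2..<m}. \<alpha> k * cnj (\<beta> k))" for m
  have z_Suc: "z (Suc m) = z m * (\<alpha> m * cnj (\<beta> m))" if "2 \<le> m" for m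
    using that by (simp add: z_def)
  have z: "cmod (z m) = 1 \<and> z m ^ 3 = \<gamma> m" if "2 \<le> m" "m \<le> n" for m
    using that
  proof (induction m rule: nat_induct_at_least)
    case base
    then show ?case using \<zeta> by (simp add: z_def)
  next
    case (Suc m)
    then have m: "1 \<le> m" "2 \<le> m" "m < n"
      by auto
    have pos: "0 < \<phi> (Suc m)"
      using perron_frobenius_digraph.eigenvector_pos[OF cell_system.axioms(1)[OF W]] m by simp
    have "\<gamma> (Suc m) = (\<alpha> m * cnj (\<beta> m)) ^ 3 * \<gamma> m"
    proof (rule phase_recursion[OF adjacent_loops[OF W m(2,3)]])
      show "of_real (inverse (\<phi> (Suc m))) * (\<gamma> (Suc m) * tri_val n W (Suc m) (Suc m) (Suc m)) *
          cnj (\<alpha> m * tri_val n W m (Suc m) (Suc m)) ^ 2 * (\<beta> m * tri_val n W m m (Suc m))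
        + of_real (inverse (\<phi> m)) * (\<gamma> m * tri_val n W m m m) * cnj (\<beta> m * tri_val n W m m (Suc m)) ^ 2 *
          (\<alpha> m * tri_val n W m (Suc m) (Suc m)) = 0"
        using adjacent_loops[OF W' m(2,3)] \<alpha>[OF m(1,3)] \<beta>[OF m(2,3)] \<gamma>[of m] \<gamma>[of "Suc m"] m by simp
    qed (use m pos nzA nzB nzC \<alpha> \<beta> unit in auto)
    then show ?case
      using Suc \<alpha>[OF m(1,3)] \<beta>[OF m(2,3)] z_Suc[OF m(2)]
      by (simp add: norm_mult power_mult_distrib mult_ac)
  qed
  define p where "p m = \<alpha> m * cnj (z (Suc m))" for m
  have p_unit: "cmod (p m) = 1" if "1 \<le> m" "m < n" for m
    using \<alpha>[of m] z[of "Suc m"] that by (simp add: p_def norm_mult)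
  have p_up: "p m * z (Suc m) = \<alpha> m" if "1 \<le> m" "m < n" for m
    using unit[of "z (Suc m)"] z[of "Suc m"] that by (simp add: p_def mult.assoc mult.commute[of "cnj _"])
  have p_down: "p m * z m = \<beta> m" if m: "2 \<le> m" "m < n" for m
  proof -
    have "p m * z m = (\<alpha> m * cnj (\<alpha> m)) * (z m * cnj (z m)) * \<beta> m"
      unfolding p_def z_Suc[OF m(1)] by (simp add: mult_ac)
    then show ?thesis
      using unit[of "\<alpha> m"] \<alpha>[of m] unit[of "z m"] z[of m] m by simp
  qed
  define u where "u i j = (if i = j then z i else if j = Suc i then p i else 1)" for i j
  have u_unit: "u i j * cnj (u i j) = 1" if "adj n i j" for i j
    using that z[of i] p_unit[of i] unit by (auto simp: u_def adj_def)
  have equiv: "tri_val n W' a b c = u a b * u b c * u c a * tri_val n W a b c"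
    if "adj n a b" "adj n b c" "adj n c a" for a b c
  proof (rule triangle_vertex_cases[OF that, where P = "\<lambda>a b c. tri_val n W' a b c = u a b * u b c * u c a * tri_val n W a b c"])
    show "tri_val n W' b c a = u b c * u c a * u a b * tri_val n W b c a"
      if "tri_val n W' a b c = u a b * u b c * u c a * tri_val n W a b c" for a b c
      using that tri_val_rotate[OF W, of a b c] tri_val_rotate[OF W', of a b c] by (simp add: mult_ac)
    show "tri_val n W' m m m = u m m * u m m * u m m * tri_val n W m m m" if "2 \<le> m" "m \<le> n" for m
      using \<gamma>[OF that] z[OF that] by (simp add: u_def power3_eq_cube)
    show "tri_val n W' m m (Suc m) = u m m * u m (Suc m) * u (Suc m) m * tri_val n W m m (Suc m)"
      if "2 \<le> m" "m < n" for m
      using \<beta>[OF that] p_down[OF that] by (simp add: u_def mult.commute[of "z m"])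
    show "tri_val n W' m (Suc m) (Suc m) = u m (Suc m) * u (Suc m) (Suc m) * u (Suc m) m * tri_val n W m (Suc m) (Suc m)"
      if "1 \<le> m" "m < n" for m
      using \<alpha>[OF that] p_up[OF that] by (simp add: u_def)
  qed
  show ?thesis
    unfolding cell_equiv_def
  proof (intro exI[of _ "\<lambda>i j _ _. u i j"] conjI ballI)
    show "unitary_on (arcs_from_to (A_star n) i j) (\<lambda>_ _. u i j)" for i j
      using u_unit[of i j] by (simp add: unitary_on_def arcs_from_to_A_star mult.commute)
  next
    fix i j k \<sigma> \<rho> \<tau>
    assume "\<sigma> \<in> arcs_from_to (A_star n) i j" "\<rho> \<in> arcs_from_to (A_star n) j k" "\<tau> \<in> arcs_from_to (A_star n) k i"
    then have a: "adj n i j" "adj n j k" "adj n k i" and e: "\<sigma> = (i, j)" "\<rho> = (j, k)" "\<tau> = (k, i)"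
      by (auto simp: arcs_from_to_A_star split: if_splits)
    show "W' \<sigma> \<rho> \<tau> = (\<Sum>\<sigma>'\<in>arcs_from_to (A_star n) i j. \<Sum>\<rho>'\<in>arcs_from_to (A_star n) j k.
        \<Sum>\<gamma>'\<in>arcs_from_to (A_star n) k i. u i j * u j k * u k i * W \<sigma>' \<rho>' \<gamma>')"
      using equiv[OF a] a unfolding e by (simp add: arcs_from_to_A_star tri_val_def cell_def)
  qed
next
  case False
  then have "\<not> adj n i j" for i j
    by (auto simp: adj_def)
  then show ?thesis
    by (simp add: cell_equiv_def unitary_on_def arcs_from_to_A_star)
qed

section \<open>Classification of the cell systems\<close>

lemma star_cells_unique:
  assumes n: "2 \<le> n" and W: "cell_system (A_star n) (2 * n + 1) (A_star_vec n) W"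
  shows "cell_equiv (A_star n) W (star_cells n)"
proof (rule cell_equiv_A_star[OF cell_system_star_cells[OF n] W])
  let ?q = "qint (2 * n + 1)" and ?\<phi> = "A_star_vec n"
  show "tri_val n (star_cells n) m (Suc m) (Suc m) \<noteq> 0" if m: "1 \<le> m" "m < n" for m
  proof -
    have "0 < ?q m" "0 < ?q (Suc m)" "0 < ?\<phi> m" "0 < ?\<phi> (Suc m)"
      using m by (auto intro!: qint_pos A_star_vec_pos)
    then have "upper_cell n (Suc m) \<noteq> 0"
      by (simp add: upper_cell_Suc)
    moreover have "tri_val n (star_cells n) m (Suc m) (Suc m) = of_real (star_cell n m (Suc m) (Suc m))"
      by (rule tri_val_star_cells) (use m in \<open>simp_all add: adj_def\<close>)
    ultimately show ?thesis by simp
  qed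
  show "tri_val n (star_cells n) m m (Suc m) \<noteq> 0" if m: "2 \<le> m" "m < n" for m
  proof -
    obtain l where l: "m = Suc l" "1 \<le> l"
      using m by (cases m) auto
    have "0 < ?q l" "0 < ?q m" "0 < ?\<phi> m" "0 < ?\<phi> (Suc m)"
      using m l by (auto intro!: qint_pos A_star_vec_pos)
    then have "lower_cell n m \<noteq> 0"
      by (simp add: lower_cell_Suc l)
    moreover have "tri_val n (star_cells n) m m (Suc m) = of_real (star_cell n m m (Suc m))"
      by (rule tri_val_star_cells) (use m in \<open>simp_all add: adj_def\<close>)
    ultimately show ?thesis by simp
  qed
  show "tri_val n (star_cells n) m m m \<noteq> 0" if m: "2 \<le> m" "m \<le> n" for m
  proof -
    obtain l where l: "m = Suc l" "1 \<le> l"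
      using m by (cases m) auto
    have "0 < ?q l" "0 < ?q m" "0 < ?\<phi> m"
      using m l by (auto intro!: qint_pos A_star_vec_pos)
    then have "loop_cell n m \<noteq> 0"
      by (simp add: loop_cell_Suc l)
    moreover have "tri_val n (star_cells n) m m m = of_real (star_cell n m m m)"
      by (rule tri_val_star_cells) (use m in \<open>simp_all add: adj_def\<close>)
    ultimately show ?thesis by simp
  qed
qed

theorem theorem7p1:
  fixes n :: nat
  assumes "2 \<le> n"
  shows "\<exists>W. cell_system (A_star n) (2 * n + 1) (A_star_vec n) W \<and>
    (\<forall>i\<in>{2..n}. cell W (i - 1) i i =
       of_real (sqrt (qint (2 * n + 1) i * qint (2 * n + 1) (2 * i - 3) * qint (2 * n + 1) (2 * i - 1))
                / sqrt (qint (2 * n + 1) (i - 1)))) \<and>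
    (\<forall>i\<in>{2..n - 1}. cell W i i (i + 1) =
       of_real (sqrt (qint (2 * n + 1) (i - 1) * qint (2 * n + 1) (2 * i - 1) * qint (2 * n + 1) (2 * i + 1))
                / sqrt (qint (2 * n + 1) i))) \<and>
    (\<forall>i\<in>{2..n}. cell W i i i =
       of_real ((-1) ^ (i + 1) * (qint (2 * n + 1) (2 * i - 1)
                / sqrt (qint (2 * n + 1) (i - 1) * qint (2 * n + 1) i)))) \<and>
    (\<forall>W'. cell_system (A_star n) (2 * n + 1) (A_star_vec n) W' \<longrightarrow> cell_equiv (A_star n) W' W)"
proof (intro exI[of _ "star_cells n"] conjI ballI allI impI)
  show "cell_system (A_star n) (2 * n + 1) (A_star_vec n) (star_cells n)"
    by (rule cell_system_star_cells[OF assms])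
next
  fix i assume "i \<in> {2..n}"
  then obtain m where "i = Suc m"
    by (cases i) auto
  then have "cell (star_cells n) (i - 1) i i = of_real (upper_cell n i)"
    by simp
  then show "cell (star_cells n) (i - 1) i i =
       of_real (sqrt (qint (2 * n + 1) i * qint (2 * n + 1) (2 * i - 3) * qint (2 * n + 1) (2 * i - 1))
                / sqrt (qint (2 * n + 1) (i - 1)))"
    unfolding upper_cell_def .
next
  fix i
  have "cell (star_cells n) i i (i + 1) = of_real (lower_cell n i)"
    by simp
  then show "cell (star_cells n) i i (i + 1) =
       of_real (sqrt (qint (2 * n + 1) (i - 1) * qint (2 * n + 1) (2 * i - 1) * qint (2 * n + 1) (2 * i + 1))
                / sqrt (qint (2 * n + 1) i))"
    unfolding lower_cell_def .
next
  fix i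
  have "cell (star_cells n) i i i = of_real (loop_cell n i)"
    by simp
  then show "cell (star_cells n) i i i =
       of_real ((-1) ^ (i + 1) * (qint (2 * n + 1) (2 * i - 1)
                / sqrt (qint (2 * n + 1) (i - 1) * qint (2 * n + 1) i)))"
    unfolding loop_cell_def .
next
  fix W' assume "cell_system (A_star n) (2 * n + 1) (A_star_vec n) W'"
  then show "cell_equiv (A_star n) W' (star_cells n)"
    by (rule star_cells_unique[OF assms])
qed

end
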